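(* Assume $\lambda^*/n\to0$, $\lambda^*\to\infty$, and that the limits $\lambda_j/\lambda^*\to\lambda^0_j\in[0,1]$ and $\sqrt{\lambda^*}/\lambda_j\to\psi_j\in[0,\infty]$ exist for all $j$. Then every open set $\mathcal{O}\subseteq\mathbb{R}^p$ with $\mathcal{M}\subseteq\mathcal{O}$ satisfies $$\lim_{n\to\infty}\inf_{\beta\in\mathbb{R}^p}P_\beta\Big(\beta\in\hat\beta_{AL}-\sqrt{\tfrac{\lambda^*}{n}}\,\mathcal{O}\Big)=1.$$ Moreover, for $d>0$ let $\mathcal{M}_d=\mathcal{M}(d\lambda^0,\psi)$. Then for every $0<d<1$, $$\lim_{n\to\infty}\inf_{\beta\in\mathbb{R}^p}P_\beta\Big(\beta\in\hat\beta_{AL}-\sqrt{\tfrac{\lambda^*}{n}}\,\mathcal{M}_d\Big)=0.$$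
   Context: For each $n\ge p$: linear regression model $y=X\beta+\varepsilon$ with $y\in\mathbb{R}^n$, non-stochastic $X\in\mathbb{R}^{n\times p}$ ($p$ fixed) of full column rank, unknown $\beta\in\mathbb{R}^p$, and $\varepsilon$ with i.i.d. components of mean zero and finite variance $\sigma^2>0$; $P_\beta$ is the probability when the true parameter is $\beta$. $X'X/n\to C$ positive definite, and $\sqrt{n}(X'X)^{-1}X'\varepsilon\overset{d}{\longrightarrow}N(0,\sigma^2C^{-1})$. $\hat\beta_{LS}=(X'X)^{-1}X'y$; the events $\{\hat\beta_{LS,j}=0\}$ have probability zero and are excluded. Non-negative tuning parameters $\lambda_j=\lambda_{n,j}$ (each either positive for all large $n$ or zero for all large $n$), $\lambda^*=\max_j\lambda_j$, convention $\sqrt{\lambda^*}/0=\infty$. Adaptive Lasso: $\hat\beta_{AL}=\arg\min_{b\in\mathbb{R}^p}\big(\|y-Xb\|^2+2\sum_{j=1}^p\lambda_j|b_j|/|\hat\beta_{LS,j}|\big)$. For $\mu\in[0,\infty)^p$ and $\psi\in[0,\infty]^p$, $\mathcal{M}(\mu,\psi)=\{m\in\mathbb{R}^p:(Cm)_j=0\text{ if }\psi_j=\infty,\ m_j(Cm)_j\le\mu_j\text{ if }\psi_j<\infty\}$, and $\mathcal{M}=\mathcal{M}(\lambda^0,\psi)$. For a set $S$ and scalar $c$, $\hat\beta_{AL}-cS=\{\hat\beta_{AL}-cs:s\in S\}$. *)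

theory Defs
  imports "HOL-Analysis.Analysis" "HOL-Probability.Probability"
begin

text \<open>Coordinates are indexed by a finite type 'p (so p = CARD('p) is fixed).
  The design for sample size n is given by its rows X n i (i < n).\<close>

definition XtX :: "(nat \<Rightarrow> nat \<Rightarrow> real^'p) \<Rightarrow> nat \<Rightarrow> real^'p^'p" where
  "XtX X n = (\<Sum>i<n. (\<chi> j k. (X n i $ j) * (X n i $ k)))"

definition Xty :: "(nat \<Rightarrow> nat \<Rightarrow> real^'p) \<Rightarrow> nat \<Rightarrow> (nat \<Rightarrow> real) \<Rightarrow> real^'p" where
  "Xty X n y = (\<Sum>i<n. y i *\<^sub>R X n i)"

definition LS :: "(nat \<Rightarrow> nat \<Rightarrow> real^'p) \<Rightarrow> nat \<Rightarrow> (nat \<Rightarrow> real) \<Rightarrow> real^'p" where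
  "LS X n y = matrix_inv (XtX X n) *v Xty X n y"

definition RSS :: "(nat \<Rightarrow> nat \<Rightarrow> real^'p) \<Rightarrow> nat \<Rightarrow> (nat \<Rightarrow> real) \<Rightarrow> real^'p \<Rightarrow> real" where
  "RSS X n y b = (\<Sum>i<n. (y i - X n i \<bullet> b)\<^sup>2)"

text \<open>Adaptive Lasso objective and estimator (a minimizer; unique whenever all
  least-squares components are nonzero, the only case that matters).\<close>
definition AL_obj :: "(nat \<Rightarrow> nat \<Rightarrow> real^'p) \<Rightarrow> (nat \<Rightarrow> 'p \<Rightarrow> real) \<Rightarrow> nat \<Rightarrow> (nat \<Rightarrow> real) \<Rightarrow> real^'p \<Rightarrow> real" where
  "AL_obj X lam n y b = RSS X n y b + 2 * (\<Sum>j\<in>UNIV. lam n j * \<bar>b $ j\<bar> / \<bar>LS X n y $ j\<bar>)"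

definition AL :: "(nat \<Rightarrow> nat \<Rightarrow> real^'p) \<Rightarrow> (nat \<Rightarrow> 'p \<Rightarrow> real) \<Rightarrow> nat \<Rightarrow> (nat \<Rightarrow> real) \<Rightarrow> real^'p" where
  "AL X lam n y = (SOME b. \<forall>c. AL_obj X lam n y b \<le> AL_obj X lam n y c)"

definition lamstar :: "(nat \<Rightarrow> 'p::finite \<Rightarrow> real) \<Rightarrow> nat \<Rightarrow> real" where
  "lamstar lam n = Max (range (lam n))"

definition psi_ratio :: "(nat \<Rightarrow> 'p::finite \<Rightarrow> real) \<Rightarrow> nat \<Rightarrow> 'p \<Rightarrow> ereal" where
  "psi_ratio lam n j = (if lam n j = 0 then \<infinity> else ereal (sqrt (lamstar lam n) / lam n j))"

definition Mset :: "real^'p^'p \<Rightarrow> ('p \<Rightarrow> real) \<Rightarrow> ('p \<Rightarrow> ereal) \<Rightarrow> (real^'p) set" where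
  "Mset C mu psi = {m. \<forall>j. (psi j = \<infinity> \<longrightarrow> (C *v m) $ j = 0) \<and>
                           (psi j < \<infinity> \<longrightarrow> m $ j * (C *v m) $ j \<le> mu j)}"

definition yobs :: "(nat \<Rightarrow> nat \<Rightarrow> real^'p) \<Rightarrow> real^'p \<Rightarrow> (nat \<Rightarrow> 'a \<Rightarrow> real) \<Rightarrow> nat \<Rightarrow> 'a \<Rightarrow> nat \<Rightarrow> real" where
  "yobs X beta eps n \<omega> i = X n i \<bullet> beta + eps i \<omega>"

text \<open>P_beta(beta \<in> AL - c S), c = sqrt(lambda*/n), with the probability-zero events
  {LS_j = 0} excluded.\<close>
definition cover_prob :: "'a measure \<Rightarrow> (nat \<Rightarrow> 'a \<Rightarrow> real) \<Rightarrow> (nat \<Rightarrow> nat \<Rightarrow> real^'p) \<Rightarrow>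
     (nat \<Rightarrow> 'p \<Rightarrow> real) \<Rightarrow> nat \<Rightarrow> (real^'p) set \<Rightarrow> real^'p \<Rightarrow> real" where
  "cover_prob M eps X lam n S beta =
     measure M {\<omega> \<in> space M. (\<forall>j. LS X n (yobs X beta eps n \<omega>) $ j \<noteq> 0) \<and>
        beta \<in> (\<lambda>s. AL X lam n (yobs X beta eps n \<omega>) - sqrt (lamstar lam n / real n) *\<^sub>R s) ` S}"

definition mvnormal :: "real^'p^'p \<Rightarrow> (real^'p) measure" where
  "mvnormal S = density lborel (\<lambda>x. ennreal ((2 * pi) powr (- real CARD('p) / 2) / sqrt (det S)
        * exp (- (x \<bullet> (matrix_inv S *v x)) / 2)))"

definition pos_def :: "real^'p^'p \<Rightarrow> bool" where
  "pos_def C \<longleftrightarrow> transpose C = C \<and> (\<forall>x. x \<noteq> 0 \<longrightarrow> x \<bullet> (C *v x) > 0)"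

definition conv_distr :: "'a measure \<Rightarrow> (nat \<Rightarrow> 'a \<Rightarrow> real^'p) \<Rightarrow> (real^'p) measure \<Rightarrow> bool" where
  "conv_distr M Z N \<longleftrightarrow> (\<forall>f::real^'p \<Rightarrow> real. continuous_on UNIV f \<and> bounded (range f) \<longrightarrow>
      (\<lambda>n. integral\<^sup>L M (\<lambda>\<omega>. f (Z n \<omega>))) \<longlonglongrightarrow> integral\<^sup>L N f)"

end

theory Submission
  imports Defs
begin

text \<open>
  Write \<open>u\<close> for the least-squares estimator, \<open>b\<close> for the adaptive Lasso, \<open>G = X'X\<close> and
  \<open>w = b - u\<close>. Whatever \<open>\<beta>\<close> is, the first-order conditions give \<open>w\<^sub>j (G w)\<^sub>j \<le> \<lambda>\<^sub>j\<close> and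
  \<open>\<bar>(G w)\<^sub>j\<bar> \<le> \<lambda>\<^sub>j / \<bar>u\<^sub>j\<bar>\<close>. After dividing by the rate \<open>a = sqrt (\<lambda>\<^sup>* / n)\<close> the vectors \<open>w / a\<close>
  are bounded, \<open>(u - \<beta>) / a\<close> vanishes because \<open>sqrt n (u - \<beta>)\<close> is tight and \<open>\<lambda>\<^sup>* \<rightarrow> \<infinity>\<close>, and every
  cluster point \<open>v\<close> of \<open>(b - \<beta>) / a\<close> satisfies \<open>v\<^sub>j (C v)\<^sub>j \<le> \<lambda>\<^sup>0\<^sub>j\<close>. If \<open>\<psi>\<^sub>j = \<infinity>\<close>, the second
  inequality yields \<open>(C v)\<^sub>j = 0\<close> as soon as \<open>sqrt n \<bar>u\<^sub>j\<bar>\<close> stays away from zero, which has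
  probability close to one uniformly in \<open>\<beta>\<close> since the Gaussian limit has no mass on hyperplanes.
  Hence cluster points lie in \<open>M\<close>, and compactness gives the first claim.

  For the second claim pick \<open>j\<close> with \<open>\<lambda>\<^sup>0\<^sub>j = 1\<close>, let \<open>h\<close> be the \<open>j\<close>-th column of the inverse of
  \<open>C\<close>, and take \<open>\<beta>\<^sub>j = a sqrt h\<^sub>j\<close> and all other coordinates equal to 1. The cluster points then
  have \<open>(C v)\<^sub>k = 0\<close> for \<open>k \<noteq> j\<close> and \<open>v\<^sub>j (C v)\<^sub>j = 1 > d\<close>.
\<close>

subsection \<open>Positive definite matrices\<close>

lemma tendsto_matrix_vector_mult:
  fixes A :: "'a \<Rightarrow> real^'n^'m"
  assumes "(A \<longlongrightarrow> B) F" "(x \<longlongrightarrow> y) F"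
  shows "((\<lambda>i. A i *v x i) \<longlongrightarrow> B *v y) F"
  unfolding matrix_vector_mult_def
  by (intro tendsto_vec_lambda tendsto_sum tendsto_mult tendsto_vec_nth assms)

lemma continuous_on_matrix_vector_mult:
  fixes A :: "real^'n^'m"
  assumes "continuous_on S f"
  shows "continuous_on S (\<lambda>x. A *v f x)"
  using assms unfolding continuous_on_def by (auto intro: tendsto_matrix_vector_mult[OF tendsto_const])

lemma matrix_inv_mult_cancel:
  fixes A :: "real^'n^'n"
  assumes "invertible A"
  shows "matrix_inv A *v (A *v x) = x" "A *v (matrix_inv A *v x) = x"
proof -
  have "A ** matrix_inv A = mat 1 \<and> matrix_inv A ** A = mat 1"
    using assms unfolding invertible_def matrix_inv_def by (rule someI_ex)
  then show "matrix_inv A *v (A *v x) = x" "A *v (matrix_inv A *v x) = x"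
    by (simp_all add: matrix_vector_mul_assoc)
qed

lemma symmetric_inner_mult:
  fixes A :: "real^'n^'n"
  assumes "transpose A = A"
  shows "x \<bullet> (A *v y) = (A *v x) \<bullet> y"
  by (metis assms dot_lmul_matrix vector_transpose_matrix)

text \<open>By compactness the quadratic form attains its minimum on the unit sphere. This minimum
  serves as \<open>k\<close>; it is positive by definiteness, and homogeneity of degree two carries
  the bound to all vectors.\<close>

lemma pos_def_lower_bound:
  fixes A :: "real^'n^'n"
  assumes "pos_def A"
  obtains k where "k > 0" "\<And>x. k * (norm x)\<^sup>2 \<le> x \<bullet> (A *v x)"
proof -
  have cont: "continuous_on (sphere 0 1) (\<lambda>x. x \<bullet> (A *v x))"
    by (intro continuous_intros continuous_on_matrix_vector_mult)
  obtain b :: "real^'n" where "norm b = 1"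
    using vector_choose_size[of 1] by auto
  then have ne: "sphere (0::real^'n) 1 \<noteq> {}"
    by auto
  obtain z where z: "z \<in> sphere 0 1" "\<And>x. x \<in> sphere 0 1 \<Longrightarrow> z \<bullet> (A *v z) \<le> x \<bullet> (A *v x)"
    using continuous_attains_inf[OF compact_sphere ne cont] by blast
  have "z \<bullet> (A *v z) > 0"
    using z(1) assms unfolding pos_def_def by (metis dist_0_norm mem_sphere norm_zero zero_neq_one)
  moreover have "(z \<bullet> (A *v z)) * (norm x)\<^sup>2 \<le> x \<bullet> (A *v x)" for x
  proof (cases "x = 0")
    case False
    have "z \<bullet> (A *v z) \<le> (x /\<^sub>R norm x) \<bullet> (A *v (x /\<^sub>R norm x))"
      using False by (intro z) auto
    also have "\<dots> = (x \<bullet> (A *v x)) / (norm x)\<^sup>2"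
      by (simp add: matrix_vector_mult_scaleR power2_eq_square divide_inverse)
    finally show ?thesis
      using False by (simp add: pos_le_divide_eq)
  qed simp
  ultimately show ?thesis
    using that by blast
qed

lemma pos_def_injective:
  fixes A :: "real^'n^'n"
  assumes "pos_def A" "A *v x = A *v y"
  shows "x = y"
proof (rule ccontr)
  assume "x \<noteq> y"
  then have "(x - y) \<bullet> (A *v (x - y)) > 0"
    using assms(1) by (simp add: pos_def_def)
  then show False
    using assms(2) by (simp add: matrix_vector_mult_diff_distrib)
qed

subsection \<open>First-order conditions\<close>

text \<open>Subgradient conditions for the objective below: the second equation forces the gradient
  coordinate to be \<open>- sgn (b $ j) * l j / \<bar>u $ j\<bar>\<close> when \<open>b $ j \<noteq> 0\<close> and is void otherwise.\<close>
definition kkt :: "real^'n^'n \<Rightarrow> ('n \<Rightarrow> real) \<Rightarrow> real^'n \<Rightarrow> real^'n \<Rightarrow> bool" where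
  "kkt G l u b \<longleftrightarrow> (\<forall>j. \<bar>(G *v (b - u)) $ j\<bar> \<le> l j / \<bar>u $ j\<bar> \<and>
                        (G *v (b - u)) $ j * b $ j = - (l j / \<bar>u $ j\<bar>) * \<bar>b $ j\<bar>)"

text \<open>Up to a term free of \<open>b\<close>, this is the Lasso criterion with the residual sum
  of squares expanded around its least-squares minimizer \<open>u\<close>; see
  \<open>AL_obj_eq_pen_obj\<close>.\<close>

definition pen_obj :: "real^'n^'n \<Rightarrow> ('n \<Rightarrow> real) \<Rightarrow> real^'n \<Rightarrow> real^'n \<Rightarrow> real" where
  "pen_obj G l u b = (b - u) \<bullet> (G *v (b - u)) + 2 * (\<Sum>j\<in>UNIV. l j * \<bar>b $ j\<bar> / \<bar>u $ j\<bar>)"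

text \<open>Divide by \<open>t\<close> and let it tend to 0 from the right. This turns inequalities
  for finite steps into first-order conditions.\<close>

lemma nonneg_if_perturbation_nonneg:
  fixes x y :: real
  assumes "\<And>t. 0 < t \<Longrightarrow> t < 1 \<Longrightarrow> 0 \<le> t * x + t\<^sup>2 * y"
  shows "0 \<le> x"
proof -
  have "((\<lambda>t. x + t * y) \<longlongrightarrow> x + 0 * y) (at_right 0)"
    by (intro tendsto_intros)
  moreover have "eventually (\<lambda>t. 0 \<le> x + t * y) (at_right 0)"
    unfolding eventually_at_right_field
  proof (intro exI[of _ 1] conjI allI impI)
    fix t :: real
    assume t: "0 < t" "t < 1"
    then have "0 \<le> t * (x + t * y)"
      using assms[OF t] by (simp add: algebra_simps power2_eq_square)
    with t show "0 \<le> x + t * y"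
      by (simp add: zero_le_mult_iff)
  qed simp
  ultimately show ?thesis
    using tendsto_lowerbound[of "\<lambda>t. x + t * y" "x + 0 * y" "at_right 0" 0] by simp
qed

text \<open>The hypothesis is what minimality says about one coordinate with value \<open>B\<close>.
  Small steps of both signs bound \<open>g\<close>. Shrinking \<open>B\<close> towards 0 gives
  \<open>g * B \<le> - s * \<bar>B\<bar>\<close>, and the bound on \<open>g\<close> supplies the
  reverse inequality.\<close>

lemma kkt_scalar:
  fixes g A s B :: real
  assumes min: "\<And>t. 0 \<le> 2 * t * g + t\<^sup>2 * A + 2 * s * (\<bar>B + t\<bar> - \<bar>B\<bar>)" and "s \<ge> 0"
  shows "\<bar>g\<bar> \<le> s" "g * B = - s * \<bar>B\<bar>"
proof -
  have tri: "0 \<le> 2 * t * g + t\<^sup>2 * A + 2 * s * \<bar>t\<bar>" for t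
  proof -
    have "s * (\<bar>B + t\<bar> - \<bar>B\<bar>) \<le> s * \<bar>t\<bar>"
      using \<open>s \<ge> 0\<close> by (intro mult_left_mono) auto
    with min[of t] show ?thesis by linarith
  qed
  have "0 \<le> 2 * (g + s)"
  proof (rule nonneg_if_perturbation_nonneg[of _ A])
    fix t :: real assume "0 < t" "t < 1"
    then show "0 \<le> t * (2 * (g + s)) + t\<^sup>2 * A"
      using tri[of t] by (simp add: algebra_simps)
  qed
  moreover have "0 \<le> 2 * (s - g)"
  proof (rule nonneg_if_perturbation_nonneg[of _ A])
    fix t :: real assume "0 < t" "t < 1"
    then show "0 \<le> t * (2 * (s - g)) + t\<^sup>2 * A"
      using tri[of "-t"] by (simp add: algebra_simps)
  qed
  ultimately show le: "\<bar>g\<bar> \<le> s"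
    by (auto simp: abs_le_iff)
  have "0 \<le> 2 * (- (g * B) - s * \<bar>B\<bar>)"
  proof (rule nonneg_if_perturbation_nonneg[of _ "B\<^sup>2 * A"])
    fix t :: real assume t: "0 < t" "t < 1"
    have "\<bar>B + - t * B\<bar> = (1 - t) * \<bar>B\<bar>"
      using t abs_mult[of "1 - t" B] by (simp add: algebra_simps)
    then have *: "\<bar>B + - t * B\<bar> - \<bar>B\<bar> = - (t * \<bar>B\<bar>)"
      by (simp add: left_diff_distrib)
    show "0 \<le> t * (2 * (- (g * B) - s * \<bar>B\<bar>)) + t\<^sup>2 * (B\<^sup>2 * A)"
      using min[of "- t * B"] unfolding * by (simp add: algebra_simps power_mult_distrib)
  qed
  moreover have "\<bar>g * B\<bar> \<le> s * \<bar>B\<bar>"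
    using le by (simp add: abs_mult mult_right_mono)
  ultimately show "g * B = - s * \<bar>B\<bar>"
    by (auto simp: abs_le_iff mult.commute)
qed

lemma kkt_if_minimizer:
  fixes G :: "real^'n^'n"
  assumes sym: "transpose G = G" and l: "\<And>j. l j \<ge> 0"
    and min: "\<And>c. pen_obj G l u b \<le> pen_obj G l u c"
  shows "kkt G l u b"
proof -
  have "0 \<le> 2 * t * (G *v (b - u)) $ j + t\<^sup>2 * (G *v axis j 1) $ j
      + 2 * (l j / \<bar>u $ j\<bar>) * (\<bar>b $ j + t\<bar> - \<bar>b $ j\<bar>)" for j t
  proof -
    \<comment> \<open>Only coordinate \<open>j\<close> moves, so all other penalty terms cancel, and
      symmetry of \<open>G\<close> merges the two cross terms of the quadratic form.\<close>
    define c where "c = b + t *\<^sub>R axis j 1"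
    have c: "c - u = (b - u) + t *\<^sub>R axis j 1"
      by (simp add: c_def)
    have ax: "axis j 1 \<bullet> x = x $ j" for x :: "real^'n"
      by (simp add: inner_axis')
    define w where "w = b - u"
    have "w \<bullet> (G *v axis j 1) = (G *v w) $ j"
      using symmetric_inner_mult[OF sym, of w "axis j 1"] by (simp add: ax inner_commute)
    then have "(c - u) \<bullet> (G *v (c - u)) = (b - u) \<bullet> (G *v (b - u)) + 2 * t * (G *v (b - u)) $ j
        + t\<^sup>2 * (G *v axis j 1) $ j"
      unfolding c w_def[symmetric]
      by (simp add: matrix_vector_right_distrib matrix_vector_mult_scaleR inner_add_left
          inner_add_right ax power2_eq_square distrib_left)
    moreover have "2 * (\<Sum>i\<in>UNIV. l i * \<bar>c $ i\<bar> / \<bar>u $ i\<bar>) - 2 * (\<Sum>i\<in>UNIV. l i * \<bar>b $ i\<bar> / \<bar>u $ i\<bar>)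
        = 2 * (l j / \<bar>u $ j\<bar>) * (\<bar>b $ j + t\<bar> - \<bar>b $ j\<bar>)"
    proof -
      have "(\<Sum>i\<in>UNIV. l i * \<bar>c $ i\<bar> / \<bar>u $ i\<bar>) - (\<Sum>i\<in>UNIV. l i * \<bar>b $ i\<bar> / \<bar>u $ i\<bar>)
          = (\<Sum>i\<in>UNIV. if i = j then (l j / \<bar>u $ j\<bar>) * (\<bar>b $ j + t\<bar> - \<bar>b $ j\<bar>) else 0)"
        unfolding sum_subtractf[symmetric]
        by (rule sum.cong) (auto simp: c_def axis_def diff_divide_distrib algebra_simps)
      then show ?thesis by (simp flip: right_diff_distrib)
    qed
    ultimately show ?thesis
      using min[of c] unfolding pen_obj_def by linarith
  qed
  then show ?thesis
    unfolding kkt_def using kkt_scalar l by (metis abs_ge_zero divide_nonneg_nonneg)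
qed

lemma minimizer_exists:
  fixes G :: "real^'n^'n"
  assumes pd: "pos_def G" and l: "\<And>j. l j \<ge> 0"
  shows "\<exists>b. \<forall>c. pen_obj G l u b \<le> pen_obj G l u c"
proof -
  obtain k where k: "k > 0" "\<And>x. k * (norm x)\<^sup>2 \<le> x \<bullet> (G *v x)"
    using pos_def_lower_bound[OF pd] by blast
  \<comment> \<open>The quadratic part vanishes at \<open>u\<close>. Outside the ball of this radius
    it alone exceeds the objective at \<open>u\<close>, so minimizing over the compact ball
    suffices.\<close>
  define R where "R = sqrt (pen_obj G l u u / k)"
  have pos: "pen_obj G l u u \<ge> 0"
    using l by (auto simp: pen_obj_def intro!: sum_nonneg)
  have "continuous_on (cball u R) (pen_obj G l u)"
    unfolding pen_obj_def divide_inverse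
    by (intro continuous_intros continuous_on_matrix_vector_mult)
  moreover have ne: "u \<in> cball u R"
    using pos k(1) by (simp add: R_def)
  ultimately obtain b where b: "b \<in> cball u R" "\<And>c. c \<in> cball u R \<Longrightarrow> pen_obj G l u b \<le> pen_obj G l u c"
    using continuous_attains_inf[of "cball u R" "pen_obj G l u"] by (metis compact_cball empty_iff)
  have "pen_obj G l u b \<le> pen_obj G l u c" for c
  proof (cases "c \<in> cball u R")
    case False
    then have "norm (c - u) > R"
      by (simp add: dist_norm norm_minus_commute)
    then have "(norm (c - u))\<^sup>2 > R\<^sup>2"
      by (rule power_strict_mono) (use pos k(1) in \<open>auto simp: R_def\<close>)
    then have "k * (norm (c - u))\<^sup>2 \<ge> pen_obj G l u u"
      using pos k(1) by (simp add: R_def field_simps)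
    also have "k * (norm (c - u))\<^sup>2 \<le> pen_obj G l u c"
      unfolding pen_obj_def using k(2)[of "c - u"] l
      by (simp add: add_increasing2 sum_nonneg)
    finally show ?thesis
      using b(2)[OF ne] by linarith
  qed (use b in auto)
  then show ?thesis by blast
qed

text \<open>Each solution is tested in the variational inequality of the other and the two are
  added. What remains on the right is the shift of the centre and the change of the weights, both
  times \<open>norm (b' - b)\<close>, which cancels. Uniqueness and continuity in \<open>u\<close>
  follow.\<close>

lemma kkt_stability:
  assumes k: "\<And>x. k * (norm x)\<^sup>2 \<le> x \<bullet> (G *v x)"
    and b: "kkt G l u b" and b': "kkt G l u' b'"
  shows "k * norm (b' - b) \<le> norm (G *v (u' - u)) + (\<Sum>j\<in>UNIV. \<bar>l j / \<bar>u $ j\<bar> - l j / \<bar>u' $ j\<bar>\<bar>)"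
proof (cases "b' = b")
  case False
  let ?s = "\<lambda>u j. l j / \<bar>u $ j\<bar>"
  \<comment> \<open>The variational inequality equivalent to a zero subgradient; it holds coordinate
    by coordinate.\<close>
  have vi: "0 \<le> (c - b) \<bullet> (G *v (b - u)) + (\<Sum>j\<in>UNIV. ?s u j * (\<bar>c $ j\<bar> - \<bar>b $ j\<bar>))"
    if "kkt G l u b" for u b c
  proof -
    have "0 \<le> (c - b) $ j * (G *v (b - u)) $ j + ?s u j * (\<bar>c $ j\<bar> - \<bar>b $ j\<bar>)" for j
    proof -
      have "\<bar>(G *v (b - u)) $ j * c $ j\<bar> \<le> ?s u j * \<bar>c $ j\<bar>"
        using that unfolding kkt_def abs_mult by (intro mult_right_mono) auto
      moreover have "(G *v (b - u)) $ j * b $ j = - ?s u j * \<bar>b $ j\<bar>"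
        using that unfolding kkt_def by blast
      ultimately show ?thesis
        by (simp add: algebra_simps)
    qed
    then show ?thesis
      by (simp add: inner_vec_def flip: sum.distrib) (meson sum_nonneg)
  qed
  let ?d = "b' - b"
  have "(b' - b) \<bullet> (G *v (b - u)) + (b - b') \<bullet> (G *v (b' - u'))
      = ?d \<bullet> (G *v (u' - u)) - ?d \<bullet> (G *v ?d)"
    by (simp add: matrix_vector_mult_diff_distrib inner_diff_left inner_diff_right)
  moreover have "(\<Sum>j\<in>UNIV. ?s u j * (\<bar>b' $ j\<bar> - \<bar>b $ j\<bar>)) + (\<Sum>j\<in>UNIV. ?s u' j * (\<bar>b $ j\<bar> - \<bar>b' $ j\<bar>))
      = (\<Sum>j\<in>UNIV. (?s u j - ?s u' j) * (\<bar>b' $ j\<bar> - \<bar>b $ j\<bar>))"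
    unfolding sum.distrib[symmetric] by (rule sum.cong) (auto simp: algebra_simps)
  ultimately have "?d \<bullet> (G *v ?d) \<le> ?d \<bullet> (G *v (u' - u))
      + (\<Sum>j\<in>UNIV. (?s u j - ?s u' j) * (\<bar>b' $ j\<bar> - \<bar>b $ j\<bar>))"
    using vi[OF b, of b'] vi[OF b', of b] by linarith
  also have "\<dots> \<le> norm ?d * norm (G *v (u' - u)) + (\<Sum>j\<in>UNIV. \<bar>?s u j - ?s u' j\<bar> * norm ?d)"
  proof (intro add_mono sum_mono)
    fix j
    have "\<bar>\<bar>b' $ j\<bar> - \<bar>b $ j\<bar>\<bar> \<le> \<bar>?d $ j\<bar>"
      by simp
    also have "\<dots> \<le> norm ?d"
      by (rule component_le_norm_cart)
    finally have "\<bar>?s u j - ?s u' j\<bar> * \<bar>\<bar>b' $ j\<bar> - \<bar>b $ j\<bar>\<bar> \<le> \<bar>?s u j - ?s u' j\<bar> * norm ?d"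
      by (rule mult_left_mono) simp
    then show "(?s u j - ?s u' j) * (\<bar>b' $ j\<bar> - \<bar>b $ j\<bar>) \<le> \<bar>?s u j - ?s u' j\<bar> * norm ?d"
      by (metis abs_le_D1 abs_mult)
  qed (rule norm_cauchy_schwarz)
  finally have "k * (norm ?d)\<^sup>2 \<le> norm ?d * (norm (G *v (u' - u)) + (\<Sum>j\<in>UNIV. \<bar>?s u j - ?s u' j\<bar>))"
    using k[of ?d] by (simp add: distrib_left sum_distrib_left mult.commute)
  then have "norm ?d * (k * norm ?d) \<le> norm ?d * (norm (G *v (u' - u)) + (\<Sum>j\<in>UNIV. \<bar>?s u j - ?s u' j\<bar>))"
    by (simp add: power2_eq_square ac_simps)
  then show ?thesis
    using False by (simp add: mult_le_cancel_left_pos)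
qed (simp add: sum_nonneg)

text \<open>Split \<open>b - u\<close>: the \<open>b\<close> part contributes at most 0, and in the
  \<open>u\<close> part the factor \<open>\<bar>u $ j\<bar>\<close> cancels the denominator of the
  weight. The bound is therefore free of \<open>u\<close>, and this is the source of the product
  constraints in \<open>Mset\<close>.\<close>

lemma kkt_product_bound:
  assumes "kkt G l u b" "u $ j \<noteq> 0"
  shows "(b - u) $ j * (G *v (b - u)) $ j \<le> l j"
proof -
  let ?g = "(G *v (b - u)) $ j" and ?s = "l j / \<bar>u $ j\<bar>"
  have 1: "\<bar>?g\<bar> \<le> ?s" "?g * b $ j = - ?s * \<bar>b $ j\<bar>"
    using assms by (auto simp: kkt_def)
  have s: "0 \<le> ?s" using 1(1) by linarith
  have "(b - u) $ j * ?g = ?g * b $ j - u $ j * ?g"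
    by (simp add: algebra_simps)
  also have "\<dots> \<le> - (u $ j * ?g)"
    using s mult_nonneg_nonneg[OF s, of "\<bar>b $ j\<bar>"] unfolding 1(2) by simp
  also have "\<dots> \<le> \<bar>u $ j\<bar> * \<bar>?g\<bar>"
    by (metis abs_ge_minus_self abs_mult)
  also have "\<dots> \<le> \<bar>u $ j\<bar> * ?s"
    using 1(1) by (rule mult_left_mono) simp
  also have "\<dots> = l j"
    using assms(2) by simp
  finally show ?thesis .
qed

text \<open>The scaling divides gradient and weights alike by \<open>N * a\<close>. When
  \<open>N\<close> is the sample size and \<open>N * a\<^sup>2\<close> is the largest tuning
  parameter, the new tuning parameters are the ratios whose limits are assumed.\<close>

lemma kkt_scale:
  assumes "kkt G l u b" "N > 0" "a > 0"
  shows "kkt ((1 / N) *\<^sub>R G) (\<lambda>j. l j / (N * a\<^sup>2)) ((1 / a) *\<^sub>R u) ((1 / a) *\<^sub>R b)"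
  unfolding kkt_def
proof (intro allI conjI)
  fix j
  let ?g = "(G *v (b - u)) $ j" and ?s = "l j / \<bar>u $ j\<bar>"
  have 1: "\<bar>?g\<bar> \<le> ?s" "?g * b $ j = - ?s * \<bar>b $ j\<bar>"
    using assms by (auto simp: kkt_def)
  have v: "(1 / a) *\<^sub>R b - (1 / a) *\<^sub>R u = (1 / a) *\<^sub>R (b - u)"
    by (simp add: scaleR_diff_right)
  have g: "(((1 / N) *\<^sub>R G) *v ((1 / a) *\<^sub>R b - (1 / a) *\<^sub>R u)) $ j = ?g / (N * a)"
    unfolding v by (simp add: matrix_vector_mult_scaleR flip: scaleR_matrix_vector_assoc)
  have s: "l j / (N * a\<^sup>2) / \<bar>((1 / a) *\<^sub>R u) $ j\<bar> = ?s / (N * a)"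
    using assms by (simp add: abs_mult power2_eq_square)
  show "\<bar>(((1 / N) *\<^sub>R G) *v ((1 / a) *\<^sub>R b - (1 / a) *\<^sub>R u)) $ j\<bar>
      \<le> l j / (N * a\<^sup>2) / \<bar>((1 / a) *\<^sub>R u) $ j\<bar>"
    unfolding g s using divide_right_mono[OF 1(1), of "N * a"] assms by (simp add: abs_mult)
  show "(((1 / N) *\<^sub>R G) *v ((1 / a) *\<^sub>R b - (1 / a) *\<^sub>R u)) $ j * ((1 / a) *\<^sub>R b) $ j
      = - (l j / (N * a\<^sup>2) / \<bar>((1 / a) *\<^sub>R u) $ j\<bar>) * \<bar>((1 / a) *\<^sub>R b) $ j\<bar>"
  proof -
    have "?g / (N * a) * (b $ j / a) = (?g * b $ j) / (N * a\<^sup>2)"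
      by (simp add: power2_eq_square)
    also have "\<dots> = - (?s / (N * a)) * (\<bar>b $ j\<bar> / a)"
      unfolding 1(2) by (simp add: power2_eq_square)
    finally show ?thesis
      unfolding g s using assms by (simp add: abs_mult)
  qed
qed

lemma kkt_exists:
  fixes G :: "real^'n^'n"
  assumes "pos_def G" "\<And>j. l j \<ge> 0"
  shows "\<exists>b. kkt G l u b"
proof -
  obtain b where "\<And>c. pen_obj G l u b \<le> pen_obj G l u c"
    using minimizer_exists[of G l u, OF assms] by blast
  with assms have "kkt G l u b"
    by (intro kkt_if_minimizer) (auto simp: pos_def_def)
  then show ?thesis ..
qed

lemma kkt_unique:
  fixes G :: "real^'n^'n"
  assumes "pos_def G" "kkt G l u b" "kkt G l u b'"
  shows "b' = b"
proof -
  obtain k where k: "k > 0" "\<And>x. k * (norm x)\<^sup>2 \<le> x \<bullet> (G *v x)"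
    using pos_def_lower_bound[OF assms(1)] by blast
  have "k * norm (b' - b) \<le> 0"
    using kkt_stability[OF k(2) assms(2,3)] by simp
  then show ?thesis
    using k(1) by (simp add: mult_le_0_iff)
qed

text \<open>The right side of \<open>kkt_stability\<close> vanishes as \<open>u'\<close> tends to
  \<open>u\<close>, because the weights are continuous where no coordinate is zero. Measurability of
  the coverage events rests on this.\<close>

lemma continuous_on_kkt_solution:
  fixes G :: "real^'n^'n"
  assumes pd: "pos_def G" and g: "\<And>u. kkt G l u (g u)"
  shows "continuous_on {u. \<forall>j. u $ j \<noteq> 0} g"
  unfolding continuous_on_def
proof
  fix u :: "real^'n"
  assume u: "u \<in> {u. \<forall>j. u $ j \<noteq> 0}"
  let ?F = "at u within {u. \<forall>j. u $ j \<noteq> 0}"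
  let ?B = "\<lambda>u'. norm (G *v (u' - u)) + (\<Sum>j\<in>UNIV. \<bar>l j / \<bar>u $ j\<bar> - l j / \<bar>u' $ j\<bar>\<bar>)"
  obtain k where k: "k > 0" "\<And>x. k * (norm x)\<^sup>2 \<le> x \<bullet> (G *v x)"
    using pos_def_lower_bound[OF pd] by blast
  have "(?B \<longlongrightarrow> norm (G *v (u - u)) + (\<Sum>j\<in>UNIV. \<bar>l j / \<bar>u $ j\<bar> - l j / \<bar>u $ j\<bar>\<bar>)) ?F"
    using u by (intro tendsto_intros tendsto_matrix_vector_mult) auto
  then have "((\<lambda>u'. ?B u' / k) \<longlongrightarrow> 0 / k) ?F"
    by (intro tendsto_divide tendsto_const) (use k in auto)
  then have lim: "((\<lambda>u'. ?B u' / k) \<longlongrightarrow> 0) ?F"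
    by simp
  have "norm (g u' - g u) \<le> ?B u' / k" for u'
    using kkt_stability[OF k(2) g g, of u' u] k(1) by (simp add: pos_le_divide_eq mult.commute)
  then have "((\<lambda>u'. g u' - g u) \<longlongrightarrow> 0) ?F"
    by (intro Lim_null_comparison[OF _ lim] always_eventually) blast
  then show "(g \<longlongrightarrow> g u) ?F"
    by (simp add: LIM_zero_iff)
qed

subsection \<open>The adaptive Lasso\<close>

lemma XtX_mult: "XtX X n *v b = (\<Sum>i<n. (X n i \<bullet> b) *\<^sub>R X n i)"
proof -
  have "(XtX X n *v b) $ j = (\<Sum>i<n. (X n i \<bullet> b) *\<^sub>R X n i) $ j" for j
  proof -
    have "(XtX X n *v b) $ j = (\<Sum>k\<in>UNIV. \<Sum>i<n. X n i $ j * X n i $ k * b $ k)"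
      by (simp add: XtX_def matrix_vector_mult_def sum_distrib_right)
    also have "\<dots> = (\<Sum>i<n. \<Sum>k\<in>UNIV. X n i $ j * X n i $ k * b $ k)"
      by (rule sum.swap)
    finally show ?thesis
      by (simp add: inner_vec_def sum_distrib_left sum_distrib_right mult_ac)
  qed
  then show ?thesis
    by (simp add: vec_eq_iff)
qed

lemma pos_def_XtX:
  assumes "invertible (XtX X n)"
  shows "pos_def (XtX X n)"
  unfolding pos_def_def
proof (intro conjI allI impI)
  show "transpose (XtX X n) = XtX X n"
    by (simp add: XtX_def transpose_def vec_eq_iff mult.commute)
next
  fix x :: "real^'a"
  assume "x \<noteq> 0"
  have eq: "x \<bullet> (XtX X n *v x) = (\<Sum>i<n. (X n i \<bullet> x)\<^sup>2)"
    by (simp add: XtX_mult inner_sum_right inner_commute power2_eq_square)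
  have "(\<Sum>i<n. (X n i \<bullet> x)\<^sup>2) \<noteq> 0"
  proof
    assume "(\<Sum>i<n. (X n i \<bullet> x)\<^sup>2) = 0"
    then have "\<forall>i<n. X n i \<bullet> x = 0"
      by (subst (asm) sum_nonneg_eq_0_iff) auto
    then have "XtX X n *v x = 0"
      by (simp add: XtX_mult)
    then show False
      using matrix_inv_mult_cancel(1)[OF assms, of x] \<open>x \<noteq> 0\<close> by simp
  qed
  then show "x \<bullet> (XtX X n *v x) > 0"
    unfolding eq by (simp add: sum_nonneg order_less_le)
qed

lemma LS_yobs:
  assumes "invertible (XtX X n)"
  shows "LS X n (yobs X beta eps n \<omega>) = beta + matrix_inv (XtX X n) *v Xty X n (\<lambda>i. eps i \<omega>)"
proof -
  have "Xty X n (yobs X beta eps n \<omega>) = XtX X n *v beta + Xty X n (\<lambda>i. eps i \<omega>)"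
    by (simp add: Xty_def yobs_def XtX_mult scaleR_left_distrib sum.distrib)
  then show ?thesis
    by (simp add: LS_def matrix_vector_right_distrib matrix_inv_mult_cancel(1)[OF assms])
qed

text \<open>The normal equations make the residuals orthogonal to the columns of the design, so the
  cross term of the expanded squares disappears.\<close>

lemma AL_obj_eq_pen_obj:
  fixes X :: "nat \<Rightarrow> nat \<Rightarrow> real^'p"
  assumes "invertible (XtX X n)"
  shows "AL_obj X lam n y b = pen_obj (XtX X n) (lam n) (LS X n y) b + RSS X n y (LS X n y)"
proof -
  let ?u = "LS X n y"
  let ?d = "b - ?u"
  have normal: "(\<Sum>i<n. (y i - X n i \<bullet> ?u) *\<^sub>R X n i) = 0"
  proof -
    have "(\<Sum>i<n. (y i - X n i \<bullet> ?u) *\<^sub>R X n i) = Xty X n y - XtX X n *v ?u"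
      by (simp only: scaleR_left_diff_distrib sum_subtractf XtX_mult Xty_def)
    then show ?thesis
      by (simp add: LS_def matrix_inv_mult_cancel(2)[OF assms])
  qed
  have "RSS X n y b = (\<Sum>i<n. (y i - X n i \<bullet> ?u)\<^sup>2 - 2 * ((y i - X n i \<bullet> ?u) * (X n i \<bullet> ?d))
      + (X n i \<bullet> ?d)\<^sup>2)"
    unfolding RSS_def
  proof (intro sum.cong refl)
    fix i
    have "y i - X n i \<bullet> b = (y i - X n i \<bullet> ?u) - X n i \<bullet> ?d"
      by (simp add: inner_diff_right)
    then show "(y i - X n i \<bullet> b)\<^sup>2 = (y i - X n i \<bullet> ?u)\<^sup>2 - 2 * ((y i - X n i \<bullet> ?u) * (X n i \<bullet> ?d))
        + (X n i \<bullet> ?d)\<^sup>2"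
      by (simp only: power2_diff)
  qed
  also have "\<dots> = RSS X n y ?u - 2 * ((\<Sum>i<n. (y i - X n i \<bullet> ?u) *\<^sub>R X n i) \<bullet> ?d)
      + ?d \<bullet> (XtX X n *v ?d)"
    by (simp add: RSS_def sum.distrib sum_subtractf sum_distrib_left XtX_mult inner_sum_left
        inner_sum_right inner_commute power2_eq_square)
  finally show ?thesis
    by (simp add: AL_obj_def pen_obj_def normal)
qed

text \<open>\<open>AL\<close> is a Hilbert choice, so a minimizer must be known to exist before
  anything can be derived about it.\<close>

lemma kkt_AL:
  fixes X :: "nat \<Rightarrow> nat \<Rightarrow> real^'p"
  assumes inv: "invertible (XtX X n)" and lam: "\<And>j. lam n j \<ge> 0"
  shows "kkt (XtX X n) (lam n) (LS X n y) (AL X lam n y)"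
proof -
  have pd: "pos_def (XtX X n)"
    using inv by (rule pos_def_XtX)
  have "\<exists>b. \<forall>c. AL_obj X lam n y b \<le> AL_obj X lam n y c"
    using minimizer_exists[OF pd lam] by (simp add: AL_obj_eq_pen_obj[OF inv])
  then have "\<forall>c. AL_obj X lam n y (AL X lam n y) \<le> AL_obj X lam n y c"
    unfolding AL_def by (rule someI_ex)
  then show ?thesis
    using pd lam by (intro kkt_if_minimizer) (auto simp: AL_obj_eq_pen_obj[OF inv] pos_def_def)
qed

subsection \<open>Limits of rescaled estimation errors\<close>

text \<open>Summing the products over \<open>j\<close> bounds the quadratic form of
  \<open>Cn i\<close> at \<open>v i\<close>. Once \<open>Cn i\<close> is close to \<open>C\<close>,
  this form dominates \<open>k / 2\<close> times the squared norm.\<close>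

lemma bounded_if_products_bounded:
  fixes Cn :: "nat \<Rightarrow> real^'n^'n"
  assumes C: "Cn \<longlonglongrightarrow> C" and pd: "pos_def C"
    and \<rho>: "\<And>j. (\<lambda>i. \<rho> i j) \<longlonglongrightarrow> \<rho>0 j"
    and le: "\<And>i j. v i $ j * (Cn i *v v i) $ j \<le> \<rho> i j"
  shows "bounded (range v)"
proof -
  obtain k where k: "k > 0" "\<And>x. k * (norm x)\<^sup>2 \<le> x \<bullet> (C *v x)"
    using pos_def_lower_bound[OF pd] by blast
  \<comment> \<open>The sum of absolute entries dominates the operator norm and visibly tends to 0
    along \<open>Cn i - C\<close>.\<close>
  let ?N = "\<lambda>A::real^'n^'n. \<Sum>i\<in>UNIV. \<Sum>j\<in>UNIV. \<bar>A $ i $ j\<bar>"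
  have "(\<lambda>i. ?N (Cn i - C)) \<longlonglongrightarrow> ?N (C - C)"
    by (intro tendsto_intros C)
  then have "eventually (\<lambda>i. ?N (Cn i - C) < k / 2) sequentially"
    by (rule order_tendstoD) (use k in simp)
  moreover have "(\<lambda>i. \<Sum>j\<in>UNIV. \<rho> i j) \<longlonglongrightarrow> (\<Sum>j\<in>UNIV. \<rho>0 j)"
    by (intro tendsto_sum \<rho>)
  then have "eventually (\<lambda>i. (\<Sum>j\<in>UNIV. \<rho> i j) < (\<Sum>j\<in>UNIV. \<rho>0 j) + 1) sequentially"
    by (rule order_tendstoD) simp
  ultimately have "eventually (\<lambda>i. (norm (v i))\<^sup>2 \<le> ((\<Sum>j\<in>UNIV. \<rho>0 j) + 1) / (k / 2)) sequentially"
  proof eventually_elim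
    case (elim i)
    have "k * (norm (v i))\<^sup>2 \<le> v i \<bullet> (C *v v i)"
      by (rule k)
    also have "\<dots> = v i \<bullet> (Cn i *v v i) - v i \<bullet> ((Cn i - C) *v v i)"
      by (simp add: matrix_vector_mult_diff_rdistrib inner_diff_right)
    also have "\<dots> \<le> (\<Sum>j\<in>UNIV. \<rho> i j) + (k / 2) * (norm (v i))\<^sup>2"
    proof -
      have "v i \<bullet> (Cn i *v v i) \<le> (\<Sum>j\<in>UNIV. \<rho> i j)"
        using le by (simp add: inner_vec_def sum_mono)
      moreover have "\<bar>v i \<bullet> ((Cn i - C) *v v i)\<bar> \<le> norm (v i) * norm ((Cn i - C) *v v i)"
        by (rule Cauchy_Schwarz_ineq2)
      moreover have "norm ((Cn i - C) *v v i) \<le> ?N (Cn i - C) * norm (v i)"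
        by (rule order_trans[OF onorm[OF matrix_vector_mul_bounded_linear]
              mult_right_mono[OF onorm_le_matrix_component_sum norm_ge_zero]])
      moreover have "?N (Cn i - C) * norm (v i) \<le> (k / 2) * norm (v i)"
        using elim(1) by (intro mult_right_mono) auto
      ultimately have "\<bar>v i \<bullet> ((Cn i - C) *v v i)\<bar> \<le> norm (v i) * ((k / 2) * norm (v i))"
        by (meson mult_left_mono norm_ge_zero order_trans)
      then show ?thesis
        using \<open>v i \<bullet> (Cn i *v v i) \<le> (\<Sum>j\<in>UNIV. \<rho> i j)\<close>
        unfolding power2_eq_square mult.left_commute[of "norm (v i)" "k / 2"] by linarith
    qed
    finally have "(k / 2) * (norm (v i))\<^sup>2 \<le> (\<Sum>j\<in>UNIV. \<rho>0 j) + 1"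
      using elim(2) by simp
    then show ?case
      using pos_le_divide_eq[OF half_gt_zero[OF k(1)]] by (simp only: mult.commute)
  qed
  then have "eventually (\<lambda>i. norm (v i) \<le> sqrt (((\<Sum>j\<in>UNIV. \<rho>0 j) + 1) / (k / 2))) sequentially"
    by eventually_elim (rule real_le_rsqrt)
  then have "Bseq v"
    by (rule BfunI)
  then show ?thesis
    by (simp only: Bseq_eq_bounded)
qed

text \<open>Boundedness yields a convergent subsequence, and non-strict inequalities survive the
  limit. Where the weight tends to 0, the gradient coordinate is squeezed to 0.\<close>

lemma kkt_limit:
  fixes Cn :: "nat \<Rightarrow> real^'n^'n"
  assumes C: "Cn \<longlonglongrightarrow> C" and pd: "pos_def C"
    and \<rho>: "\<And>j. (\<lambda>i. \<rho> i j) \<longlonglongrightarrow> \<rho>0 j"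
    and kkt: "\<And>i. kkt (Cn i) (\<rho> i) (u i) (b i)" and u: "\<And>i j. u i $ j \<noteq> 0"
  obtains r v where "strict_mono (r :: nat \<Rightarrow> nat)" "(\<lambda>i. b (r i) - u (r i)) \<longlonglongrightarrow> v"
    "(\<lambda>i. Cn (r i) *v (b (r i) - u (r i))) \<longlonglongrightarrow> C *v v"
    "\<forall>j. v $ j * (C *v v) $ j \<le> \<rho>0 j"
    "\<forall>j. (\<lambda>i. \<rho> i j / \<bar>u i $ j\<bar>) \<longlonglongrightarrow> 0 \<longrightarrow> (C *v v) $ j = 0"
proof -
  have le: "(b i - u i) $ j * (Cn i *v (b i - u i)) $ j \<le> \<rho> i j" for i j
    using kkt u by (rule kkt_product_bound)
  have "bounded (range (\<lambda>i. b i - u i))"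
    using C pd \<rho> le by (rule bounded_if_products_bounded)
  then obtain v r where r: "strict_mono (r :: nat \<Rightarrow> nat)" and v: "((\<lambda>i. b i - u i) \<circ> r) \<longlonglongrightarrow> v"
    using bounded_imp_convergent_subsequence by blast
  have v': "(\<lambda>i. b (r i) - u (r i)) \<longlonglongrightarrow> v"
    using v by (simp add: comp_def)
  have Cv: "(\<lambda>i. Cn (r i) *v (b (r i) - u (r i))) \<longlonglongrightarrow> C *v v"
    using LIMSEQ_subseq_LIMSEQ[OF C r] v' by (intro tendsto_matrix_vector_mult) (simp_all add: comp_def)
  have "v $ j * (C *v v) $ j \<le> \<rho>0 j" for j
  proof (rule LIMSEQ_le)
    show "(\<lambda>i. (b (r i) - u (r i)) $ j * (Cn (r i) *v (b (r i) - u (r i))) $ j) \<longlonglongrightarrow> v $ j * (C *v v) $ j"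
      by (intro tendsto_intros v' Cv)
    show "(\<lambda>i. \<rho> (r i) j) \<longlonglongrightarrow> \<rho>0 j"
      using LIMSEQ_subseq_LIMSEQ[OF \<rho> r] by (simp add: comp_def)
  qed (use le in blast)
  moreover have "(C *v v) $ j = 0" if z: "(\<lambda>i. \<rho> i j / \<bar>u i $ j\<bar>) \<longlonglongrightarrow> 0" for j
  proof -
    have "(\<lambda>i. (Cn (r i) *v (b (r i) - u (r i))) $ j) \<longlonglongrightarrow> 0"
    proof (rule Lim_null_comparison)
      show "(\<lambda>i. \<rho> (r i) j / \<bar>u (r i) $ j\<bar>) \<longlonglongrightarrow> 0"
        using LIMSEQ_subseq_LIMSEQ[OF z r] by (simp add: comp_def)
    qed (use kkt in \<open>auto simp: kkt_def\<close>)
    then show ?thesis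
      using tendsto_vec_nth[OF Cv, of j] LIMSEQ_unique by blast
  qed
  ultimately show ?thesis
    by (intro that[OF r v' Cv]) auto
qed

text \<open>Either the coordinate of \<open>b\<close> is zero or the gradient attains its bound.
  Written as a vanishing product, the alternative passes to limits by continuity.\<close>

lemma kkt_dichotomy:
  assumes "kkt G l u b"
  shows "b $ j * (\<bar>(G *v (b - u)) $ j\<bar> - l j / \<bar>u $ j\<bar>) = 0"
proof (cases "b $ j = 0")
  case False
  let ?g = "(G *v (b - u)) $ j" and ?s = "l j / \<bar>u $ j\<bar>"
  have 1: "\<bar>?g\<bar> \<le> ?s" "?g * b $ j = - ?s * \<bar>b $ j\<bar>"
    using assms by (auto simp: kkt_def)
  then have "\<bar>?g\<bar> * \<bar>b $ j\<bar> = \<bar>?s\<bar> * \<bar>b $ j\<bar>"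
    by (metis abs_abs abs_minus_cancel abs_mult)
  moreover have "\<bar>?s\<bar> = ?s"
    using 1(1) by linarith
  ultimately show ?thesis
    using False by (simp only: mult_cancel_right) simp
qed simp

text \<open>\<open>u\<close>, \<open>b\<close> and \<open>\<beta>\<close> are indexed by the
  position along \<open>r\<close>, and \<open>s\<close> thins further. Since
  \<open>(u i - \<beta> i) / a (r i)\<close> has norm at most \<open>K / sqrt (L (r i))\<close>,
  centring at \<open>\<beta>\<close> or at \<open>u\<close> gives the same limit. The last
  conclusion is \<open>kkt_dichotomy\<close> in the limit.\<close>

lemma scaled_limit:
  fixes G :: "nat \<Rightarrow> real^'n^'n" and u b \<beta> :: "nat \<Rightarrow> real^'n" and L :: "nat \<Rightarrow> real"
  defines "a \<equiv> \<lambda>n. sqrt (L n / real n)"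
  assumes G: "(\<lambda>n. (1 / real n) *\<^sub>R G n) \<longlonglongrightarrow> C" and pd: "pos_def C"
    and L: "filterlim L at_top sequentially"
    and \<rho>: "\<And>j. (\<lambda>n. l n j / L n) \<longlonglongrightarrow> \<rho>0 j"
    and r: "strict_mono (r :: nat \<Rightarrow> nat)"
    and pos: "\<And>i. L (r i) > 0" "\<And>i. r i > 0"
    and kkt: "\<And>i. kkt (G (r i)) (l (r i)) (u i) (b i)"
    and u: "\<And>i j. u i $ j \<noteq> 0"
    and K: "\<And>i. norm (sqrt (real (r i)) *\<^sub>R (u i - \<beta> i)) \<le> K"
  obtains s v where "strict_mono (s :: nat \<Rightarrow> nat)"
    "(\<lambda>i. (1 / a (r i)) *\<^sub>R (u i - \<beta> i)) \<longlonglongrightarrow> 0"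
    "(\<lambda>i. (1 / a (r (s i))) *\<^sub>R (b (s i) - \<beta> (s i))) \<longlonglongrightarrow> v"
    "\<forall>j. v $ j * (C *v v) $ j \<le> \<rho>0 j"
    "\<forall>j. (\<lambda>i. (l (r i) j / L (r i)) / \<bar>u i $ j / a (r i)\<bar>) \<longlonglongrightarrow> 0 \<longrightarrow> (C *v v) $ j = 0"
    "\<forall>j t. t \<noteq> 0 \<longrightarrow> (\<lambda>i. u i $ j / a (r i)) \<longlonglongrightarrow> t \<longrightarrow>
        (v $ j + t) * (\<bar>(C *v v) $ j\<bar> - \<rho>0 j / \<bar>t\<bar>) = 0"
proof -
  have a: "a (r i) > 0" "real (r i) * (a (r i))\<^sup>2 = L (r i)" for i
    using pos[of i] by (auto simp: a_def)
  let ?C = "\<lambda>i. (1 / real (r i)) *\<^sub>R G (r i)"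
  let ?u = "\<lambda>i. (1 / a (r i)) *\<^sub>R u i" and ?b = "\<lambda>i. (1 / a (r i)) *\<^sub>R b i"
  have kkt': "kkt (?C i) (\<lambda>j. l (r i) j / L (r i)) (?u i) (?b i)" for i
    using kkt_scale[OF kkt[of i], of "real (r i)" "a (r i)"] a[of i] pos(2)[of i] by simp
  have C: "?C \<longlonglongrightarrow> C"
    using LIMSEQ_subseq_LIMSEQ[OF G r] by (simp add: comp_def)
  have \<rho>': "(\<lambda>i. l (r i) j / L (r i)) \<longlonglongrightarrow> \<rho>0 j" for j
    using LIMSEQ_subseq_LIMSEQ[OF \<rho> r] by (simp add: comp_def)
  have u': "?u i $ j \<noteq> 0" for i j
    using u a(1)[of i] by simp
  obtain s v where s: "strict_mono (s :: nat \<Rightarrow> nat)" and v: "(\<lambda>i. ?b (s i) - ?u (s i)) \<longlonglongrightarrow> v"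
    and Cv: "(\<lambda>i. ?C (s i) *v (?b (s i) - ?u (s i))) \<longlonglongrightarrow> C *v v"
    and le: "\<forall>j. v $ j * (C *v v) $ j \<le> \<rho>0 j"
    and zero: "\<forall>j. (\<lambda>i. (l (r i) j / L (r i)) / \<bar>?u i $ j\<bar>) \<longlonglongrightarrow> 0 \<longrightarrow> (C *v v) $ j = 0"
    by (rule kkt_limit[OF C pd \<rho>' kkt' u'])
  have err: "(\<lambda>i. (1 / a (r i)) *\<^sub>R (u i - \<beta> i)) \<longlonglongrightarrow> 0"
  proof (rule Lim_null_comparison)
    have "filterlim (\<lambda>i. sqrt (L (r i))) at_top sequentially"
      by (intro filterlim_compose[OF sqrt_at_top] filterlim_compose[OF L] filterlim_subseq r)
    then show "(\<lambda>i. K / sqrt (L (r i))) \<longlonglongrightarrow> 0"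
      by (intro tendsto_divide_0[OF tendsto_const] filterlim_at_top_imp_at_infinity)
    have "norm ((1 / a (r i)) *\<^sub>R (u i - \<beta> i)) \<le> K / sqrt (L (r i))" for i
    proof -
      have "norm ((1 / a (r i)) *\<^sub>R (u i - \<beta> i)) = norm (sqrt (real (r i)) *\<^sub>R (u i - \<beta> i)) / sqrt (L (r i))"
        using a(1)[of i] pos[of i] by (simp add: a_def real_sqrt_divide)
      also have "\<dots> \<le> K / sqrt (L (r i))"
        using K[of i] pos(1)[of i] by (intro divide_right_mono) auto
      finally show ?thesis .
    qed
    then show "eventually (\<lambda>i. norm ((1 / a (r i)) *\<^sub>R (u i - \<beta> i)) \<le> K / sqrt (L (r i))) sequentially"
      by simp
  qed
  have "(\<lambda>i. (1 / a (r (s i))) *\<^sub>R (u (s i) - \<beta> (s i))) \<longlonglongrightarrow> 0"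
    using LIMSEQ_subseq_LIMSEQ[OF err s] by (simp add: comp_def)
  from tendsto_add[OF v this]
  have m: "(\<lambda>i. (1 / a (r (s i))) *\<^sub>R (b (s i) - \<beta> (s i))) \<longlonglongrightarrow> v"
    by (simp add: scaleR_diff_right)
  have dich: "(v $ j + t) * (\<bar>(C *v v) $ j\<bar> - \<rho>0 j / \<bar>t\<bar>) = 0"
    if t: "t \<noteq> 0" "(\<lambda>i. u i $ j / a (r i)) \<longlonglongrightarrow> t" for j t
  proof -
    \<comment> \<open>The first factor is the rescaled \<open>b\<close> coordinate, written as error
      plus \<open>u\<close> because only these two have known limits.\<close>
    let ?p = "\<lambda>i. ((?b i - ?u i) $ j + u i $ j / a (r i))
        * (\<bar>(?C i *v (?b i - ?u i)) $ j\<bar> - (l (r i) j / L (r i)) / \<bar>u i $ j / a (r i)\<bar>)"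
    have "?p i = 0" for i
      using kkt_dichotomy[OF kkt'[of i], of j] by simp
    moreover have "(\<lambda>i. u (s i) $ j / a (r (s i))) \<longlonglongrightarrow> t"
      using LIMSEQ_subseq_LIMSEQ[OF t(2) s] by (simp add: comp_def)
    moreover have "(\<lambda>i. l (r (s i)) j / L (r (s i))) \<longlonglongrightarrow> \<rho>0 j"
      using LIMSEQ_subseq_LIMSEQ[OF \<rho>' s] by (simp add: comp_def)
    ultimately have "(\<lambda>i. ?p (s i)) \<longlonglongrightarrow> (v $ j + t) * (\<bar>(C *v v) $ j\<bar> - \<rho>0 j / \<bar>t\<bar>)"
      using t(1) by (intro tendsto_intros v Cv) auto
    with \<open>\<And>i. ?p i = 0\<close> show ?thesis
      by (simp only: LIMSEQ_const_iff)
  qed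
  show ?thesis
  proof (rule that[OF s err m le])
    show "\<forall>j. (\<lambda>i. (l (r i) j / L (r i)) / \<bar>u i $ j / a (r i)\<bar>) \<longlonglongrightarrow> 0 \<longrightarrow> (C *v v) $ j = 0"
      using zero by simp
  qed (use dich in blast)
qed

text \<open>The deterministic core of the first claim, uniform in \<open>u\<close>, \<open>b\<close>
  and \<open>\<beta>\<close>. Otherwise there are violations for infinitely many \<open>n\<close>;
  their cluster point lies in \<open>Mset\<close>, hence in the open set \<open>U\<close>, and so do
  late members of the subsequence.\<close>

lemma rescaled_solution_in_open:
  fixes G :: "nat \<Rightarrow> real^'n^'n" and L :: "nat \<Rightarrow> real"
  assumes G: "(\<lambda>n. (1 / real n) *\<^sub>R G n) \<longlonglongrightarrow> C" and pd: "pos_def C"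
    and L: "filterlim L at_top sequentially"
    and l: "\<And>n j. l n j \<ge> 0"
    and \<rho>: "\<And>j. (\<lambda>n. l n j / L n) \<longlonglongrightarrow> \<rho>0 j"
    and psi: "\<And>j. psi j = \<infinity> \<Longrightarrow> (\<lambda>n. l n j / sqrt (L n)) \<longlonglongrightarrow> 0"
    and U: "open U" "Mset C \<rho>0 psi \<subseteq> U" and "\<delta> > 0"
  shows "eventually (\<lambda>n. \<forall>u b \<beta>. kkt (G n) (l n) u b \<and> (\<forall>j. u $ j \<noteq> 0) \<and>
      norm (sqrt (real n) *\<^sub>R (u - \<beta>)) \<le> K \<and> (\<forall>j. \<delta> \<le> \<bar>sqrt (real n) * u $ j\<bar>)
      \<longrightarrow> (1 / sqrt (L n / real n)) *\<^sub>R (b - \<beta>) \<in> U) sequentially" (is "eventually ?P _")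
proof (rule ccontr)
  assume nP: "\<not> eventually ?P sequentially"
  have ev: "eventually (\<lambda>n. L n > 0 \<and> n > 0) sequentially"
    using L eventually_gt_at_top[of 0] by (auto simp: filterlim_at_top_dense eventually_conj_iff)
  \<comment> \<open>Making positivity a premise ensures that every index of the extracted
    subsequence, not just late ones, satisfies it.\<close>
  have "\<not> eventually (\<lambda>n. L n > 0 \<and> n > 0 \<longrightarrow> ?P n) sequentially"
    using nP eventually_mp[of "\<lambda>n. L n > 0 \<and> n > 0" ?P, OF _ ev] by (rule contrapos_nn)
  from not_eventually_sequentiallyD[OF this] obtain r where r: "strict_mono (r :: nat \<Rightarrow> nat)"
    and bad: "\<And>i. \<not> (L (r i) > 0 \<and> r i > 0 \<longrightarrow> ?P (r i))"
    by blast
  have pos: "L (r i) > 0" "r i > 0" for i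
    using bad[of i] by blast+
  have "\<forall>i. \<exists>u b \<beta>. kkt (G (r i)) (l (r i)) u b \<and> (\<forall>j. u $ j \<noteq> 0) \<and>
      norm (sqrt (real (r i)) *\<^sub>R (u - \<beta>)) \<le> K \<and> (\<forall>j. \<delta> \<le> \<bar>sqrt (real (r i)) * u $ j\<bar>)
      \<and> (1 / sqrt (L (r i) / real (r i))) *\<^sub>R (b - \<beta>) \<notin> U"
    using bad by blast
  then obtain u b \<beta> where kkt: "\<And>i. kkt (G (r i)) (l (r i)) (u i) (b i)"
    and u: "\<And>i j. u i $ j \<noteq> 0" and K: "\<And>i. norm (sqrt (real (r i)) *\<^sub>R (u i - \<beta> i)) \<le> K"
    and \<delta>: "\<And>i j. \<delta> \<le> \<bar>sqrt (real (r i)) * u i $ j\<bar>"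
    and notin: "\<And>i. (1 / sqrt (L (r i) / real (r i))) *\<^sub>R (b i - \<beta> i) \<notin> U"
    unfolding choice_iff by blast
  obtain s v where "strict_mono (s :: nat \<Rightarrow> nat)"
    and m: "(\<lambda>i. (1 / sqrt (L (r (s i)) / real (r (s i)))) *\<^sub>R (b (s i) - \<beta> (s i))) \<longlonglongrightarrow> v"
    and le: "\<forall>j. v $ j * (C *v v) $ j \<le> \<rho>0 j"
    and zero: "\<forall>j. (\<lambda>i. (l (r i) j / L (r i)) / \<bar>u i $ j / sqrt (L (r i) / real (r i))\<bar>) \<longlonglongrightarrow> 0
        \<longrightarrow> (C *v v) $ j = 0"
    by (rule scaled_limit[OF G pd L \<rho> r pos kkt u K])
  have "(C *v v) $ j = 0" if "psi j = \<infinity>" for j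
  proof (rule zero[rule_format], rule Lim_null_comparison)
    have "(\<lambda>i. (l (r i) j / sqrt (L (r i)))) \<longlonglongrightarrow> 0"
      using LIMSEQ_subseq_LIMSEQ[OF psi[OF that] r] by (simp add: comp_def)
    then show "(\<lambda>i. (l (r i) j / sqrt (L (r i))) / \<delta>) \<longlonglongrightarrow> 0"
      by (rule tendsto_divide_zero)
    have "norm ((l (r i) j / L (r i)) / \<bar>u i $ j / sqrt (L (r i) / real (r i))\<bar>)
        \<le> (l (r i) j / sqrt (L (r i))) / \<delta>" for i
    proof -
      \<comment> \<open>One factor \<open>sqrt (L (r i))\<close> moves the weight from the scale of
        \<open>a\<close> to the \<open>sqrt n\<close> scale, where \<open>\<delta>\<close> bounds
        the denominator from below.\<close>
      have "L (r i) = sqrt (L (r i)) * sqrt (L (r i))"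
        using pos[of i] by simp
      then have "(l (r i) j / L (r i)) / \<bar>u i $ j / sqrt (L (r i) / real (r i))\<bar>
          = (l (r i) j / sqrt (L (r i))) / \<bar>sqrt (real (r i)) * u i $ j\<bar>"
        using pos[of i] u[of i j] by (simp add: real_sqrt_divide abs_mult field_simps)
      also have "\<dots> \<le> (l (r i) j / sqrt (L (r i))) / \<delta>"
        using \<delta>[of i j] \<open>\<delta> > 0\<close> l[of "r i" j] pos[of i] by (intro divide_left_mono) (auto simp: u)
      finally show ?thesis
        using l[of "r i" j] pos[of i] by simp
    qed
    then show "eventually (\<lambda>i. norm ((l (r i) j / L (r i)) / \<bar>u i $ j / sqrt (L (r i) / real (r i))\<bar>)
        \<le> (l (r i) j / sqrt (L (r i))) / \<delta>) sequentially"
      by simp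
  qed
  then have "v \<in> U"
    using U(2) le by (auto simp: Mset_def)
  then have "eventually (\<lambda>i. (1 / sqrt (L (r (s i)) / real (r (s i)))) *\<^sub>R (b (s i) - \<beta> (s i)) \<in> U) sequentially"
    using topological_tendstoD[OF m U(1)] by blast
  then show False
    using notin by simp
qed

text \<open>Along \<^term>\<open>\<beta>\<close> the limit \<^term>\<open>v\<close> of the rescaled error is proportional to \<^term>\<open>h\<close>, and the
  choice \<open>t\<^sup>2 = h $ j\<close> gives \<open>v $ j * (C *v v) $ j = 1\<close> whether or not coordinate
  \<^term>\<open>j\<close> is set to zero.\<close>
lemma rescaled_solution_extreme:
  fixes G :: "nat \<Rightarrow> real^'n^'n" and L :: "nat \<Rightarrow> real"
  defines "a \<equiv> \<lambda>n. sqrt (L n / real n)"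
  assumes G: "(\<lambda>n. (1 / real n) *\<^sub>R G n) \<longlonglongrightarrow> C" and pd: "pos_def C"
    and L: "filterlim L at_top sequentially" and Ln: "(\<lambda>n. L n / real n) \<longlonglongrightarrow> 0"
    and \<rho>: "\<And>k. (\<lambda>n. l n k / L n) \<longlonglongrightarrow> \<rho>0 k" and j: "\<rho>0 j = 1"
    and h: "C *v h = axis j 1"
    and \<beta>: "\<And>n. \<beta> n = (\<chi> k. if k = j then a n * sqrt (h $ j) else 1)"
    and d: "d < 1"
  shows "eventually (\<lambda>n. \<forall>u b. kkt (G n) (l n) u b \<and> (\<forall>k. u $ k \<noteq> 0) \<and>
      norm (sqrt (real n) *\<^sub>R (u - \<beta> n)) \<le> K
      \<longrightarrow> d < ((1 / a n) *\<^sub>R (b - \<beta> n)) $ j * (C *v ((1 / a n) *\<^sub>R (b - \<beta> n))) $ j) sequentially"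
    (is "eventually ?P _")
proof (rule ccontr)
  assume nP: "\<not> eventually ?P sequentially"
  have ev: "eventually (\<lambda>n. L n > 0 \<and> n > 0) sequentially"
    using L eventually_gt_at_top[of 0] by (auto simp: filterlim_at_top_dense eventually_conj_iff)
  have "\<not> eventually (\<lambda>n. L n > 0 \<and> n > 0 \<longrightarrow> ?P n) sequentially"
    using nP eventually_mp[of "\<lambda>n. L n > 0 \<and> n > 0" ?P, OF _ ev] by (rule contrapos_nn)
  from not_eventually_sequentiallyD[OF this] obtain r where r: "strict_mono (r :: nat \<Rightarrow> nat)"
    and bad: "\<And>i. \<not> (L (r i) > 0 \<and> r i > 0 \<longrightarrow> ?P (r i))"
    by blast
  have pos: "L (r i) > 0" "r i > 0" for i
    using bad[of i] by blast+
  have "\<forall>i. \<exists>u b. kkt (G (r i)) (l (r i)) u b \<and> (\<forall>k. u $ k \<noteq> 0) \<and>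
      norm (sqrt (real (r i)) *\<^sub>R (u - \<beta> (r i))) \<le> K \<and>
      \<not> d < ((1 / a (r i)) *\<^sub>R (b - \<beta> (r i))) $ j * (C *v ((1 / a (r i)) *\<^sub>R (b - \<beta> (r i)))) $ j"
    using bad by blast
  then obtain u b where kkt: "\<And>i. kkt (G (r i)) (l (r i)) (u i) (b i)"
    and u: "\<And>i k. u i $ k \<noteq> 0" and K: "\<And>i. norm (sqrt (real (r i)) *\<^sub>R (u i - \<beta> (r i))) \<le> K"
    and notin: "\<And>i. \<not> d < ((1 / a (r i)) *\<^sub>R (b i - \<beta> (r i))) $ j * (C *v ((1 / a (r i)) *\<^sub>R (b i - \<beta> (r i)))) $ j"
    unfolding choice_iff by blast
  obtain s v where "strict_mono (s :: nat \<Rightarrow> nat)"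
    and err: "(\<lambda>i. (1 / a (r i)) *\<^sub>R (u i - \<beta> (r i))) \<longlonglongrightarrow> 0"
    and m: "(\<lambda>i. (1 / a (r (s i))) *\<^sub>R (b (s i) - \<beta> (r (s i)))) \<longlonglongrightarrow> v"
    and zero: "\<forall>k. (\<lambda>i. (l (r i) k / L (r i)) / \<bar>u i $ k / a (r i)\<bar>) \<longlonglongrightarrow> 0 \<longrightarrow> (C *v v) $ k = 0"
    and dich: "\<forall>k t. t \<noteq> 0 \<longrightarrow> (\<lambda>i. u i $ k / a (r i)) \<longlonglongrightarrow> t \<longrightarrow>
        (v $ k + t) * (\<bar>(C *v v) $ k\<bar> - \<rho>0 k / \<bar>t\<bar>) = 0"
    unfolding a_def by (rule scaled_limit[OF G pd L \<rho> r pos kkt u K])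
  have a: "a (r i) > 0" for i
    using pos[of i] by (simp add: a_def)
  have "h \<noteq> 0"
    using h by (auto simp: axis_eq_0_iff)
  \<comment> \<open>This inner product is \<open>h $ j\<close>, so the square root below is that of
    a positive number.\<close>
  then have "h \<bullet> (C *v h) > 0"
    using pd by (simp add: pos_def_def)
  then have hj: "h $ j > 0"
    by (simp add: h inner_axis)
  define t where "t = sqrt (h $ j)"
  have t: "t > 0" "h $ j = t * t"
    using hj by (auto simp: t_def)
  \<comment> \<open>For \<open>k \<noteq> j\<close> the true coordinate is 1 while \<open>a\<close>
    tends to 0, so the rescaled \<open>u\<close> coordinate diverges and the weight
    vanishes.\<close>
  have "(C *v v) $ k = 0" if "k \<noteq> j" for k
  proof (rule zero[rule_format])
    have "(\<lambda>n. a n) \<longlonglongrightarrow> sqrt 0"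
      unfolding a_def by (intro tendsto_real_sqrt Ln)
    then have "(\<lambda>i. a (r i)) \<longlonglongrightarrow> 0"
      using LIMSEQ_subseq_LIMSEQ[OF _ r, of a "sqrt 0"] by (simp add: comp_def)
    then have "filterlim (\<lambda>i. inverse (a (r i))) at_top sequentially"
      using a by (intro filterlim_inverse_at_top) auto
    then have "filterlim (\<lambda>i. ((1 / a (r i)) *\<^sub>R (u i - \<beta> (r i))) $ k + inverse (a (r i))) at_top sequentially"
      using tendsto_vec_nth[OF err] by (rule filterlim_tendsto_add_at_top[rotated])
    then have "filterlim (\<lambda>i. u i $ k / a (r i)) at_top sequentially"
      using that by (simp add: \<beta> divide_inverse algebra_simps)
    then have "filterlim (\<lambda>i. \<bar>u i $ k / a (r i)\<bar>) at_infinity sequentially"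
      by (intro filterlim_at_top_imp_at_infinity filterlim_compose[OF filterlim_abs_real])
    then show "(\<lambda>i. (l (r i) k / L (r i)) / \<bar>u i $ k / a (r i)\<bar>) \<longlonglongrightarrow> 0"
      using LIMSEQ_subseq_LIMSEQ[OF \<rho> r] by (intro tendsto_divide_0) (simp_all add: comp_def)
  qed
  \<comment> \<open>Only coordinate \<open>j\<close> of \<open>C *v v\<close> survives, so
    injectivity makes \<open>v\<close> a multiple of \<open>h\<close>.\<close>
  then have "C *v v = C *v ((C *v v) $ j *\<^sub>R h)"
    by (auto simp: matrix_vector_mult_scaleR h vec_eq_iff axis_def)
  then have "v = (C *v v) $ j *\<^sub>R h"
    by (rule pos_def_injective[OF pd])
  then have vj: "v $ j = (C *v v) $ j * (t * t)"
    using t(2) by (metis vector_scaleR_component real_scaleR_def)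
  have "(\<lambda>i. ((1 / a (r i)) *\<^sub>R (u i - \<beta> (r i))) $ j + t) \<longlonglongrightarrow> 0 $ j + t"
    by (intro tendsto_intros err)
  moreover have "((1 / a (r i)) *\<^sub>R (u i - \<beta> (r i))) $ j + t = u i $ j / a (r i)" for i
    using a[of i] by (simp add: \<beta> t_def field_simps)
  ultimately have "(v $ j + t) * (\<bar>(C *v v) $ j\<bar> - 1 / \<bar>t\<bar>) = 0"
    using dich[rule_format, of t j] t(1) j by simp
  then have "v $ j = - t \<or> \<bar>(C *v v) $ j\<bar> = 1 / t"
    using t(1) by (auto simp: eq_neg_iff_add_eq_0)
  \<comment> \<open>Put \<open>q = (C *v v) $ j\<close>, so that
    \<open>v $ j = q * t\<^sup>2\<close>. The first case gives \<open>q = - 1 / t\<close>, the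
    second \<open>\<bar>q\<bar> = 1 / t\<close>; in both the product is
    \<open>q\<^sup>2 * t\<^sup>2 = 1\<close>.\<close>
  then have "v $ j * (C *v v) $ j = 1"
  proof
    assume "v $ j = - t"
    with vj have "t * ((C *v v) $ j * t) = t * (- 1)"
      by (simp add: mult_ac)
    then have "(C *v v) $ j * t = - 1"
      using t(1) by (simp only: mult_cancel_left) simp
    with \<open>v $ j = - t\<close> show ?thesis
      by (simp add: mult.commute)
  next
    assume q: "\<bar>(C *v v) $ j\<bar> = 1 / t"
    have "v $ j * (C *v v) $ j = (t * \<bar>(C *v v) $ j\<bar>) * (t * \<bar>(C *v v) $ j\<bar>)"
      unfolding vj by (simp add: mult_ac)
    with q t(1) show ?thesis by simp
  qed
  moreover have "(\<lambda>i. ((1 / a (r (s i))) *\<^sub>R (b (s i) - \<beta> (r (s i)))) $ j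
      * (C *v ((1 / a (r (s i))) *\<^sub>R (b (s i) - \<beta> (r (s i))))) $ j) \<longlonglongrightarrow> v $ j * (C *v v) $ j"
    by (intro tendsto_mult tendsto_vec_nth tendsto_matrix_vector_mult tendsto_const m)
  ultimately have "eventually (\<lambda>i. d < ((1 / a (r (s i))) *\<^sub>R (b (s i) - \<beta> (r (s i)))) $ j
      * (C *v ((1 / a (r (s i))) *\<^sub>R (b (s i) - \<beta> (r (s i))))) $ j) sequentially"
    using d by (intro order_tendstoD) auto
  then show False
    using notin by simp
qed

subsection \<open>Consequences of the central limit theorem\<close>

lemma sets_mvnormal: "sets (mvnormal S) = sets borel"
  by (simp add: mvnormal_def)

text \<open>The measure has a density with respect to Lebesgue measure, under which hyperplanes are
  null. Null sets of the completion are passed to \<open>lborel\<close> because hyperplanes are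
  closed.\<close>

lemma mvnormal_hyperplane_null:
  fixes S :: "real^'p^'p"
  shows "measure (mvnormal S) {x. x $ j = s} = 0"
proof -
  have "closed {x::real^'p. x $ j = s}"
    by (intro closed_Collect_eq continuous_intros)
  then have meas: "{x::real^'p. x $ j = s} \<in> sets lborel"
    by simp
  have "{x::real^'p. x $ j = s} \<in> null_sets (completion lborel)"
    using negligible_standard_hyperplane[of "axis j 1 :: real^'p" s]
    by (simp add: negligible_iff_null_sets inner_axis axis_in_Basis_iff)
  then have "{x::real^'p. x $ j = s} \<in> null_sets lborel"
    using meas null_sets_completion_iff by blast
  moreover have "(\<lambda>x. ennreal ((2 * pi) powr (- real CARD('p) / 2) / sqrt (det S)
        * exp (- (x \<bullet> (matrix_inv S *v x)) / 2))) \<in> borel_measurable (lborel :: (real^'p) measure)"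
  proof -
    have "continuous_on UNIV (\<lambda>x::real^'p. x \<bullet> (matrix_inv S *v x))"
      by (intro continuous_intros continuous_on_matrix_vector_mult)
    then have "(\<lambda>x::real^'p. x \<bullet> (matrix_inv S *v x)) \<in> borel_measurable borel"
      by (rule borel_measurable_continuous_onI)
    then show ?thesis
      by simp
  qed
  moreover from calculation(1)
  have "AE x in lborel. x \<in> {x::real^'p. x $ j = s} \<longrightarrow>
      ennreal ((2 * pi) powr (- real CARD('p) / 2) / sqrt (det S)
        * exp (- (x \<bullet> (matrix_inv S *v x)) / 2)) = 0"
    by (rule AE_mp[OF AE_not_in]) simp
  ultimately have "{x. x $ j = s} \<in> null_sets (mvnormal S)"
    unfolding mvnormal_def using meas by (simp only: null_sets_density_iff simp_thms)
  then show ?thesis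
    by (auto simp: measure_def null_sets_def)
qed

lemma conv_distrD:
  fixes f :: "real^'p \<Rightarrow> real"
  assumes "conv_distr M Z N" "continuous_on UNIV f" "bounded (range f)"
  shows "(\<lambda>n. integral\<^sup>L M (\<lambda>\<omega>. f (Z n \<omega>))) \<longlonglongrightarrow> integral\<^sup>L N f"
  using assms by (simp add: conv_distr_def)

context
  fixes M :: "'a measure" and Z :: "nat \<Rightarrow> 'a \<Rightarrow> real^'p" and N :: "(real^'p) measure"
  assumes M: "prob_space M" and Z[measurable]: "\<And>n. Z n \<in> borel_measurable M"
    and sets_N[measurable_cong]: "sets N = sets borel" and conv: "conv_distr M Z N"
begin

text \<open>The total mass of the limit is read off the test function 1.\<close>
lemma conv_distr_prob_space_limit: "prob_space N"
proof -
  interpret prob_space M by (rule M)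
  have "(\<lambda>n. integral\<^sup>L M (\<lambda>\<omega>. 1 :: real)) \<longlonglongrightarrow> integral\<^sup>L N (\<lambda>x. 1)"
    by (rule conv_distrD[OF conv, of "\<lambda>_. 1"]) simp_all
  then have "measure N (space N) = 1"
    by (simp add: prob_space LIMSEQ_const_iff)
  moreover from this have "emeasure N (space N) \<noteq> top"
    by (auto simp: measure_def)
  ultimately show ?thesis
    by (intro prob_spaceI) (simp add: emeasure_eq_ennreal_measure)
qed

text \<open>The closed-set half of the portmanteau theorem: a continuous function is squeezed
  between the indicators of \<open>F\<close> and of a closed neighbourhood whose limit mass is still
  below \<open>\<eta>\<close>.\<close>

lemma conv_distr_closed:
  assumes F: "closed F" and less: "measure N F < \<eta>"
  shows "eventually (\<lambda>n. measure M {\<omega> \<in> space M. Z n \<omega> \<in> F} < \<eta>) sequentially"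
\<comment> \<open>The distance \<open>infdist\<close> to the empty set is 0 by convention, so the
  neighbourhoods below would not shrink to it.\<close>
proof (cases "F = {}")
  case True
  then show ?thesis using less by simp
next
  case False
  interpret M: prob_space M by (rule M)
  interpret N: prob_space N by (rule conv_distr_prob_space_limit)
  define A where "A k = {x. infdist x F \<le> inverse (real (Suc k))}" for k
  have A: "A k \<in> sets N" for k
    unfolding A_def sets_N by (intro borel_closed closed_Collect_le continuous_intros)
  have "decseq A"
    unfolding A_def decseq_def by (auto intro: order_trans le_imp_inverse_le)
  moreover have "(\<Inter>k. A k) = F"
  proof (intro equalityI subsetI)
    fix x assume "x \<in> (\<Inter>k. A k)"
    then have "infdist x F \<le> 0"
      by (intro LIMSEQ_le_const[OF LIMSEQ_inverse_real_of_nat]) (auto simp: A_def)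
    then show "x \<in> F"
      using in_closed_iff_infdist_zero[OF F False, of x] infdist_nonneg[of x F] by simp
  qed (auto simp: A_def)
  ultimately have "(\<lambda>k. measure N (A k)) \<longlonglongrightarrow> measure N F"
    using N.finite_Lim_measure_decseq[of A] A by auto
  then have "eventually (\<lambda>k. measure N (A k) < \<eta>) sequentially"
    using less by (rule order_tendstoD)
  then obtain k where k: "measure N (A k) < \<eta>"
    using eventually_happens'[OF sequentially_bot] by blast
  \<comment> \<open>Equal to 1 on \<open>F\<close> and to 0 off \<open>A k\<close>.\<close>
  define f where "f x = max 0 (1 - real (Suc k) * infdist x F)" for x
  have cont: "continuous_on UNIV f"
    unfolding f_def by (intro continuous_intros)
  then have [measurable]: "f \<in> borel_measurable borel"
    by (rule borel_measurable_continuous_onI)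
  have f: "0 \<le> f x" "f x \<le> 1" for x
    by (auto simp: f_def infdist_nonneg)
  have "bounded (range f)"
    by (rule boundedI[of _ 1]) (use f in auto)
  then have lim: "(\<lambda>n. integral\<^sup>L M (\<lambda>\<omega>. f (Z n \<omega>))) \<longlonglongrightarrow> integral\<^sup>L N f"
    by (rule conv_distrD[OF conv cont])
  have "integral\<^sup>L N f \<le> integral\<^sup>L N (indicator (A k))"
  proof (rule integral_mono)
    show "integrable N f"
      by (rule N.integrable_const_bound[of _ 1]) (use f in auto)
    show "integrable N (indicator (A k) :: _ \<Rightarrow> real)"
      using A[of k] by (simp add: N.emeasure_eq_measure)
    show "f x \<le> indicator (A k) x" for x
    proof (cases "x \<in> A k")
      case False
      then have "1 < real (Suc k) * infdist x F"
        by (simp add: A_def field_simps)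
      then show ?thesis
        by (simp add: f_def)
    qed (use f in auto)
  qed
  also have "\<dots> = measure N (A k)"
    using A by simp
  finally have "eventually (\<lambda>n. integral\<^sup>L M (\<lambda>\<omega>. f (Z n \<omega>)) < \<eta>) sequentially"
    using k by (intro order_tendstoD[OF lim]) simp
  then show ?thesis
  proof eventually_elim
    case (elim n)
    have [measurable]: "F \<in> sets borel"
      using F by simp
    have B: "{\<omega> \<in> space M. Z n \<omega> \<in> F} \<in> sets M"
      by measurable
    have "measure M {\<omega> \<in> space M. Z n \<omega> \<in> F} = integral\<^sup>L M (indicator {\<omega> \<in> space M. Z n \<omega> \<in> F})"
      using B by simp
    also have "\<dots> \<le> integral\<^sup>L M (\<lambda>\<omega>. f (Z n \<omega>))"
    proof (rule integral_mono)
      show "integrable M (indicator {\<omega> \<in> space M. Z n \<omega> \<in> F} :: _ \<Rightarrow> real)"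
        using B by (simp add: M.emeasure_eq_measure)
      show "integrable M (\<lambda>\<omega>. f (Z n \<omega>))"
        by (rule M.integrable_const_bound[of _ 1]) (use f in auto)
      show "indicator {\<omega> \<in> space M. Z n \<omega> \<in> F} \<omega> \<le> f (Z n \<omega>)" for \<omega>
        using f by (auto simp: indicator_def) (simp add: f_def)
    qed
    finally show ?case
      using elim by simp
  qed
qed

text \<open>Complements of open balls are closed and decrease to the empty set, so one of them has
  small limit mass.\<close>

lemma conv_distr_tight:
  assumes "\<eta> > 0"
  obtains K where "eventually (\<lambda>n. measure M {\<omega> \<in> space M. norm (Z n \<omega>) \<ge> K} < \<eta>) sequentially"
proof -
  interpret N: prob_space N by (rule conv_distr_prob_space_limit)
  define A where "A k = {x::real^'p. norm x \<ge> real k}" for k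
  have closed: "closed (A k)" for k
    unfolding A_def by (intro closed_Collect_le continuous_intros)
  have "decseq A"
    unfolding A_def decseq_def by auto
  moreover have "(\<Inter>k. A k) = {}"
  proof -
    have "\<exists>k. x \<notin> A k" for x
      using reals_Archimedean2[of "norm x"] by (auto simp: A_def not_le)
    then show ?thesis by blast
  qed
  ultimately have "(\<lambda>k. measure N (A k)) \<longlonglongrightarrow> 0"
    using N.finite_Lim_measure_decseq[of A] closed by (simp add: sets_N image_subset_iff)
  then have "eventually (\<lambda>k. measure N (A k) < \<eta>) sequentially"
    using assms by (rule order_tendstoD)
  then obtain k where "measure N (A k) < \<eta>"
    using eventually_happens'[OF sequentially_bot] by blast
  then show ?thesis
    using conv_distr_closed[OF closed] that[of "real k"] by (simp add: A_def)
qed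

text \<open>Tightness reduces the uniformity in \<^term>\<open>t\<close> to a compact range, which finitely many
  small intervals cover.\<close>
lemma conv_distr_anti_concentration:
  assumes null: "\<And>s. measure N {x. x $ j = s} = 0" and "\<eta> > 0"
  obtains \<delta> where "\<delta> > 0"
    "eventually (\<lambda>n. \<forall>t. measure M {\<omega> \<in> space M. \<bar>Z n \<omega> $ j + t\<bar> < \<delta>} < \<eta>) sequentially"
proof -
  interpret M: prob_space M by (rule M)
  interpret N: prob_space N by (rule conv_distr_prob_space_limit)
  obtain K where K: "eventually (\<lambda>n. measure M {\<omega> \<in> space M. norm (Z n \<omega>) \<ge> K} < \<eta>) sequentially"
    using conv_distr_tight \<open>\<eta> > 0\<close> by blast
  \<comment> \<open>The factor 2 leaves room for both the distance from \<open>- t\<close> to the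
    centre \<open>s\<close> and the width \<open>\<delta>\<close>, each at most
    \<open>d s\<close>.\<close>
  have "\<forall>s. \<exists>d. d > 0 \<and> eventually (\<lambda>n. measure M {\<omega> \<in> space M. \<bar>Z n \<omega> $ j - s\<bar> \<le> 2 * d} < \<eta>) sequentially"
  proof
    fix s
    define A where "A k = {x::real^'p. \<bar>x $ j - s\<bar> \<le> inverse (real (Suc k))}" for k
    have closed: "closed (A k)" for k
      unfolding A_def by (intro closed_Collect_le continuous_intros)
    have "decseq A"
      unfolding A_def decseq_def by (auto intro: order_trans le_imp_inverse_le)
    moreover have "(\<Inter>k. A k) = {x. x $ j = s}"
    proof (intro equalityI subsetI)
      fix x assume "x \<in> (\<Inter>k. A k)"
      then have "\<bar>x $ j - s\<bar> \<le> 0"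
        by (intro LIMSEQ_le_const[OF LIMSEQ_inverse_real_of_nat]) (auto simp: A_def)
      then show "x \<in> {x. x $ j = s}" by simp
    qed (auto simp: A_def)
    ultimately have "(\<lambda>k. measure N (A k)) \<longlonglongrightarrow> 0"
      using N.finite_Lim_measure_decseq[of A] closed null by (simp add: sets_N image_subset_iff)
    then have "eventually (\<lambda>k. measure N (A k) < \<eta>) sequentially"
      using \<open>\<eta> > 0\<close> by (rule order_tendstoD)
    then obtain k where "measure N (A k) < \<eta>"
      using eventually_happens'[OF sequentially_bot] by blast
    then have "eventually (\<lambda>n. measure M {\<omega> \<in> space M. Z n \<omega> \<in> A k} < \<eta>) sequentially"
      by (rule conv_distr_closed[OF closed])
    then show "\<exists>d. d > 0 \<and> eventually (\<lambda>n. measure M {\<omega> \<in> space M. \<bar>Z n \<omega> $ j - s\<bar> \<le> 2 * d} < \<eta>) sequentially"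
      by (intro exI[of _ "inverse (real (Suc k)) / 2"]) (simp add: A_def)
  qed
  from choice[OF this] obtain d where d: "\<And>s. d s > 0"
    "\<And>s. eventually (\<lambda>n. measure M {\<omega> \<in> space M. \<bar>Z n \<omega> $ j - s\<bar> \<le> 2 * d s} < \<eta>) sequentially"
    by auto
  \<comment> \<open>The margin 1 absorbs \<open>\<delta> \<le> 1\<close>: if \<open>- t\<close> lies
    outside, closeness of \<open>Z n \<omega> $ j\<close> to \<open>- t\<close> already forces a
    norm of at least \<open>K\<close>.\<close>
  let ?I = "{-(\<bar>K\<bar> + 1)..\<bar>K\<bar> + 1}"
  have cover: "?I \<subseteq> (\<Union>s\<in>?I. ball s (d s))"
    using d(1) by auto
  obtain T where T: "T \<subseteq> ?I" "finite T" "?I \<subseteq> (\<Union>s\<in>T. ball s (d s))"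
    by (rule compactE_image[OF compact_Icc _ cover]) (rule open_ball)
  define \<delta> where "\<delta> = Min (insert 1 (d ` T))"
  have \<delta>: "\<delta> > 0" "\<delta> \<le> 1" "\<And>s. s \<in> T \<Longrightarrow> \<delta> \<le> d s"
    using T(2) d(1) by (auto simp: \<delta>_def)
  have "eventually (\<lambda>n. \<forall>s\<in>T. measure M {\<omega> \<in> space M. \<bar>Z n \<omega> $ j - s\<bar> \<le> 2 * d s} < \<eta>) sequentially"
    using T(2) d(2) by (simp add: eventually_ball_finite)
  with K have "eventually (\<lambda>n. \<forall>t. measure M {\<omega> \<in> space M. \<bar>Z n \<omega> $ j + t\<bar> < \<delta>} < \<eta>) sequentially"
  proof eventually_elim
    case (elim n)
    show ?case
    proof
      fix t
      show "measure M {\<omega> \<in> space M. \<bar>Z n \<omega> $ j + t\<bar> < \<delta>} < \<eta>"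
      proof (cases "- t \<in> ?I")
        case True
        then have "- t \<in> (\<Union>s\<in>T. ball s (d s))"
          using T(3) by blast
        then obtain s where s: "s \<in> T" "\<bar>s + t\<bar> < d s"
          by (auto simp: dist_real_def)
        have "measure M {\<omega> \<in> space M. \<bar>Z n \<omega> $ j + t\<bar> < \<delta>}
            \<le> measure M {\<omega> \<in> space M. \<bar>Z n \<omega> $ j - s\<bar> \<le> 2 * d s}"
          using s(2) \<delta>(3)[OF s(1)] by (intro M.finite_measure_mono) (auto, measurable)
        also have "\<dots> < \<eta>"
          using elim(2) s(1) by (rule bspec)
        finally show ?thesis .
      next
        case False
        have "norm (Z n \<omega>) \<ge> K" if "\<bar>Z n \<omega> $ j + t\<bar> < \<delta>" for \<omega>
          using that False \<delta>(2) component_le_norm_cart[of "Z n \<omega>" j] by auto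
        then have "measure M {\<omega> \<in> space M. \<bar>Z n \<omega> $ j + t\<bar> < \<delta>}
            \<le> measure M {\<omega> \<in> space M. norm (Z n \<omega>) \<ge> K}"
          by (intro M.finite_measure_mono) (auto, measurable)
        with elim(1) show ?thesis by simp
      qed
    qed
  qed
  with \<delta>(1) show ?thesis by (rule that)
qed

end

subsection \<open>Coverage probabilities\<close>

lemma mem_rescaled_image_iff:
  fixes x :: "real^'p"
  assumes "a \<noteq> 0"
  shows "beta \<in> (\<lambda>s. x - a *\<^sub>R s) ` S \<longleftrightarrow> (1 / a) *\<^sub>R (x - beta) \<in> S"
proof
  assume "beta \<in> (\<lambda>s. x - a *\<^sub>R s) ` S"
  then show "(1 / a) *\<^sub>R (x - beta) \<in> S"
    using assms by auto
next
  assume "(1 / a) *\<^sub>R (x - beta) \<in> S"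
  moreover have "beta = x - a *\<^sub>R ((1 / a) *\<^sub>R (x - beta))"
    using assms by simp
  ultimately show "beta \<in> (\<lambda>s. x - a *\<^sub>R s) ` S"
    by blast
qed

section \<open>Measurability of the coverage events\<close>

lemma borel_measurable_LS_error:
  fixes X :: "nat \<Rightarrow> nat \<Rightarrow> real^'p"
  assumes "\<And>i. eps i \<in> borel_measurable M"
  shows "(\<lambda>\<omega>. matrix_inv (XtX X n) *v Xty X n (\<lambda>i. eps i \<omega>)) \<in> borel_measurable M"
proof -
  have "(\<lambda>\<omega>. Xty X n (\<lambda>i. eps i \<omega>)) \<in> borel_measurable M"
    unfolding Xty_def using assms by measurable
  moreover have "(\<lambda>x. matrix_inv (XtX X n) *v x) \<in> borel_measurable borel"
    by (intro borel_measurable_continuous_onI continuous_on_matrix_vector_mult continuous_on_id)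
  ultimately show ?thesis
    by (rule measurable_compose)
qed

text \<open>On the set without zero coordinates the Lasso is a continuous function of least squares,
  so the event is a preimage of an open set. Measurability is what allows coverage to be bounded
  below through the complement.\<close>

lemma sets_cover_event:
  fixes X :: "nat \<Rightarrow> nat \<Rightarrow> real^'p"
  assumes inv: "invertible (XtX X n)" and lam: "\<And>j. lam n j \<ge> 0"
    and eps: "\<And>i. eps i \<in> borel_measurable M" and U: "open U" and a: "a \<noteq> 0"
  shows "{\<omega> \<in> space M. (\<forall>j. LS X n (yobs X beta eps n \<omega>) $ j \<noteq> 0) \<and>
      beta \<in> (\<lambda>s. AL X lam n (yobs X beta eps n \<omega>) - a *\<^sub>R s) ` U} \<in> sets M"
proof -
  have pd: "pos_def (XtX X n)"
    using inv by (rule pos_def_XtX)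
  \<comment> \<open>The solution map is total: division by 0 gives 0, so a zero coordinate of
    \<open>u\<close> just receives no penalty. By uniqueness, \<open>AL\<close> is this map applied
    to \<open>LS\<close>.\<close>
  have "\<forall>u. \<exists>b. kkt (XtX X n) (lam n) u b"
    using kkt_exists[OF pd, of "lam n"] lam by blast
  from choice[OF this] obtain g where g: "\<And>u. kkt (XtX X n) (lam n) u (g u)"
    by blast
  have AL: "AL X lam n y = g (LS X n y)" for y
    by (rule kkt_unique[OF pd g kkt_AL[of X n lam, OF inv lam]])
  let ?R = "{u::real^'p. \<forall>j. u $ j \<noteq> 0}"
  let ?W = "?R \<inter> (\<lambda>u. (1 / a) *\<^sub>R (g u - beta)) -` U"
  have "?R = (\<Inter>j. {u. u $ j \<noteq> 0})"
    by auto
  moreover have "open (\<Inter>j. {u::real^'p. u $ j \<noteq> 0})"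
    by (intro open_INT finite ballI open_Collect_neq continuous_intros)
  ultimately have "open ?R"
    by simp
  then have "open ?W"
    using U by (intro continuous_open_preimage continuous_intros continuous_on_kkt_solution[OF pd g])
  then have W: "?W \<in> sets borel"
    by simp
  have LS: "(\<lambda>\<omega>. LS X n (yobs X beta eps n \<omega>)) \<in> borel_measurable M"
    unfolding LS_yobs[OF inv] using borel_measurable_LS_error[of eps M X n, OF eps] by simp
  have "{\<omega> \<in> space M. (\<forall>j. LS X n (yobs X beta eps n \<omega>) $ j \<noteq> 0) \<and>
      beta \<in> (\<lambda>s. AL X lam n (yobs X beta eps n \<omega>) - a *\<^sub>R s) ` U}
    = (\<lambda>\<omega>. LS X n (yobs X beta eps n \<omega>)) -` ?W \<inter> space M"
    unfolding mem_rescaled_image_iff[OF a] AL by auto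
  then show ?thesis
    using measurable_sets[OF LS W] by (simp only:)
qed

section \<open>Limits of the tuning-parameter ratios\<close>

lemma ratio_tendsto_0_if_psi_ratio_infinite:
  fixes lam :: "nat \<Rightarrow> 'p::finite \<Rightarrow> real"
  assumes psi: "(\<lambda>n. psi_ratio lam n j) \<longlonglongrightarrow> \<infinity>"
    and lam: "\<And>n j. lam n j \<ge> 0" and L: "filterlim (lamstar lam) at_top sequentially"
  shows "(\<lambda>n. lam n j / sqrt (lamstar lam n)) \<longlonglongrightarrow> 0"
proof (rule tendstoI)
  fix e :: real assume e: "e > 0"
  have "eventually (\<lambda>n. psi_ratio lam n j > ereal (1 / e)) sequentially"
    using psi by (rule order_tendstoD) simp
  moreover have "eventually (\<lambda>n. lamstar lam n > 0) sequentially"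
    using L by (auto simp: filterlim_at_top_dense)
  ultimately show "eventually (\<lambda>n. dist (lam n j / sqrt (lamstar lam n)) 0 < e) sequentially"
  proof eventually_elim
    case (elim n)
    show ?case
    proof (cases "lam n j = 0")
      case False
      then have "lam n j > 0"
        using lam[of n j] by simp
      moreover have "1 / e < sqrt (lamstar lam n) / lam n j"
        using elim(1) False by (simp add: psi_ratio_def)
      ultimately show ?thesis
        using elim(2) e by (simp add: field_simps)
    qed (use e in simp)
  qed
qed

lemma lamstar_attained:
  fixes lam :: "nat \<Rightarrow> 'p::finite \<Rightarrow> real"
  shows "\<exists>j. lam n j = lamstar lam n"
proof -
  have "lamstar lam n \<in> range (lam n)"
    unfolding lamstar_def by (rule Max_in) auto
  then show ?thesis
    by auto
qed

text \<open>For each \<open>n\<close> some coordinate attains the maximum and has ratio 1. If all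
  limits were below 1, then all of the finitely many ratios would eventually be below 1.\<close>

lemma limit_ratio_attains_1:
  fixes lam :: "nat \<Rightarrow> 'p::finite \<Rightarrow> real"
  assumes lim: "\<And>j. (\<lambda>n. lam n j / lamstar lam n) \<longlonglongrightarrow> lam0 j"
    and range: "\<And>j. lam0 j \<le> 1" and L: "filterlim (lamstar lam) at_top sequentially"
  obtains j where "lam0 j = 1"
proof (rule ccontr)
  assume "\<not> thesis"
  then have "lam0 j < 1" for j
    using that range[of j] by (metis order_less_le)
  then have "eventually (\<lambda>n. lam n j / lamstar lam n < 1) sequentially" for j
    by (rule order_tendstoD(2)[OF lim])
  then have "eventually (\<lambda>n. \<forall>j. lam n j / lamstar lam n < 1) sequentially"
    by (simp add: eventually_all_finite)
  moreover have "eventually (\<lambda>n. lamstar lam n > 0) sequentially"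
    using L by (auto simp: filterlim_at_top_dense)
  ultimately have "eventually (\<lambda>n::nat. False) sequentially"
  proof eventually_elim
    case (elim n)
    obtain j where "lam n j = lamstar lam n"
      using lamstar_attained by blast
    with elim show False
      by (metis div_self less_irrefl)
  qed
  then show False by simp
qed

section \<open>The two coverage limits\<close>

lemma cover_prob_tendsto_1:
  fixes M :: "'a measure" and eps :: "nat \<Rightarrow> 'a \<Rightarrow> real" and X :: "nat \<Rightarrow> nat \<Rightarrow> real^'p::finite"
    and C S :: "real^'p^'p" and lam :: "nat \<Rightarrow> 'p \<Rightarrow> real"
  assumes prob: "prob_space M" and eps: "\<And>i. eps i \<in> borel_measurable M"
    and inv: "\<And>n. n \<ge> CARD('p) \<Longrightarrow> invertible (XtX X n)"
    and C_lim: "(\<lambda>n. (1 / real n) *\<^sub>R XtX X n) \<longlonglongrightarrow> C" and pd: "pos_def C"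
    and clt: "conv_distr M
        (\<lambda>n \<omega>. sqrt (real n) *\<^sub>R (matrix_inv (XtX X n) *v Xty X n (\<lambda>i. eps i \<omega>))) (mvnormal S)"
    and LS0: "\<And>n beta j. n \<ge> CARD('p) \<Longrightarrow>
        measure M {\<omega> \<in> space M. LS X n (yobs X beta eps n \<omega>) $ j = 0} = 0"
    and lam: "\<And>n j. lam n j \<ge> 0"
    and L: "filterlim (lamstar lam) at_top sequentially"
    and lam0: "\<And>j. (\<lambda>n. lam n j / lamstar lam n) \<longlonglongrightarrow> lam0 j"
    and psi: "\<And>j. (\<lambda>n. psi_ratio lam n j) \<longlonglongrightarrow> psi j"
    and U: "open U" "Mset C lam0 psi \<subseteq> U"
  shows "(\<lambda>n. INF beta. cover_prob M eps X lam n U beta) \<longlonglongrightarrow> 1"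
proof (rule tendstoI)
  interpret M: prob_space M by (rule prob)
  define e where "e n \<omega> = matrix_inv (XtX X n) *v Xty X n (\<lambda>i. eps i \<omega>)" for n \<omega>
  define Z where "Z n \<omega> = sqrt (real n) *\<^sub>R e n \<omega>" for n \<omega>
  have e[measurable]: "e n \<in> borel_measurable M" for n
    unfolding e_def[abs_def] using eps by (rule borel_measurable_LS_error)
  have Z[measurable]: "Z n \<in> borel_measurable M" for n
    unfolding Z_def[abs_def] by measurable
  have conv: "conv_distr M Z (mvnormal S)"
    using clt by (simp add: Z_def[abs_def] e_def)
  fix \<epsilon> :: real assume "\<epsilon> > 0"
  \<comment> \<open>One share of \<open>\<eta>\<close> for large noise and one for each coordinate
    near zero; the 2 makes the total strictly less than \<open>\<epsilon>\<close>.\<close>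
  define \<eta> where "\<eta> = \<epsilon> / (2 * (1 + real CARD('p)))"
  have \<eta>: "\<eta> > 0" "(1 + real CARD('p)) * \<eta> < \<epsilon>"
    using \<open>\<epsilon> > 0\<close> by (auto simp: \<eta>_def field_simps add_pos_pos)
  obtain K where K: "eventually (\<lambda>n. measure M {\<omega> \<in> space M. norm (Z n \<omega>) \<ge> K} < \<eta>) sequentially"
    by (rule conv_distr_tight[OF prob Z sets_mvnormal conv \<eta>(1)])
  have "\<forall>j. \<exists>\<delta>. \<delta> > 0 \<and>
      eventually (\<lambda>n. \<forall>t. measure M {\<omega> \<in> space M. \<bar>Z n \<omega> $ j + t\<bar> < \<delta>} < \<eta>) sequentially"
  proof
    fix j
    show "\<exists>\<delta>. \<delta> > 0 \<and>
      eventually (\<lambda>n. \<forall>t. measure M {\<omega> \<in> space M. \<bar>Z n \<omega> $ j + t\<bar> < \<delta>} < \<eta>) sequentially"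
      by (rule conv_distr_anti_concentration[OF prob Z sets_mvnormal conv mvnormal_hyperplane_null \<eta>(1)])
         blast
  qed
  from choice[OF this] obtain d where d: "\<And>j. d j > 0"
    "\<And>j. eventually (\<lambda>n. \<forall>t. measure M {\<omega> \<in> space M. \<bar>Z n \<omega> $ j + t\<bar> < d j} < \<eta>) sequentially"
    by auto
  define \<delta> where "\<delta> = Min (range d)"
  have \<delta>: "\<delta> > 0" "\<And>j. \<delta> \<le> d j"
    using d(1) by (auto simp: \<delta>_def)
  have det: "eventually (\<lambda>n. \<forall>u b \<beta>. kkt (XtX X n) (lam n) u b \<and> (\<forall>j. u $ j \<noteq> 0) \<and>
      norm (sqrt (real n) *\<^sub>R (u - \<beta>)) \<le> K \<and> (\<forall>j. \<delta> \<le> \<bar>sqrt (real n) * u $ j\<bar>)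
      \<longrightarrow> (1 / sqrt (lamstar lam n / real n)) *\<^sub>R (b - \<beta>) \<in> U) sequentially"
    using psi L lam by (intro rescaled_solution_in_open[OF C_lim pd L lam lam0 _ U \<delta>(1)]
        ratio_tendsto_0_if_psi_ratio_infinite) metis+
  have d2: "eventually (\<lambda>n. \<forall>j t. measure M {\<omega> \<in> space M. \<bar>Z n \<omega> $ j + t\<bar> < d j} < \<eta>) sequentially"
    using d(2) by (simp add: eventually_all_finite)
  have pos: "eventually (\<lambda>n. lamstar lam n > 0) sequentially"
    using L by (auto simp: filterlim_at_top_dense)
  show "eventually (\<lambda>n. dist (INF beta. cover_prob M eps X lam n U beta) 1 < \<epsilon>) sequentially"
    using K det d2 pos eventually_ge_at_top[of "CARD('p)"]
  proof eventually_elim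
    case (elim n)
    note K = elim(1) and det = elim(2) and d2 = elim(3) and L0 = elim(4) and n = elim(5)
    have n0: "n > 0"
      using n zero_less_card_finite[where 'a='p] by linarith
    have a0: "sqrt (lamstar lam n / real n) \<noteq> 0"
      using L0 n0 by simp
    have "1 - (1 + real CARD('p)) * \<eta> \<le> cover_prob M eps X lam n U beta" for beta
    proof -
      let ?u = "\<lambda>\<omega>. LS X n (yobs X beta eps n \<omega>)"
      let ?E = "{\<omega> \<in> space M. (\<forall>j. ?u \<omega> $ j \<noteq> 0) \<and>
        beta \<in> (\<lambda>s. AL X lam n (yobs X beta eps n \<omega>) - sqrt (lamstar lam n / real n) *\<^sub>R s) ` U}"
      let ?B0 = "{\<omega> \<in> space M. norm (Z n \<omega>) \<ge> K}"
      \<comment> \<open>The unknown parameter enters only as a shift, so uniformity over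
        \<open>t\<close> in the anti-concentration bound is uniformity over
        \<open>beta\<close>.\<close>
      let ?B1 = "\<lambda>j. {\<omega> \<in> space M. \<bar>Z n \<omega> $ j + sqrt (real n) * beta $ j\<bar> < d j}"
      let ?B2 = "\<lambda>j. {\<omega> \<in> space M. ?u \<omega> $ j = 0}"
      have u: "?u \<omega> = beta + e n \<omega>" for \<omega>
        unfolding e_def by (rule LS_yobs[OF inv[OF n]])
      have E: "?E \<in> sets M"
        using inv[OF n] lam eps U(1) a0 by (rule sets_cover_event)
      have B0: "?B0 \<in> sets M"
        by measurable
      have B1: "?B1 j \<in> sets M" for j
        by measurable
      have B2: "?B2 j \<in> sets M" for j
        unfolding u by measurable
      \<comment> \<open>Off the three exceptional kinds of event the deterministic lemma applies, so
        a union bound with terms free of \<open>beta\<close> controls the infimum.\<close>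
      have "space M \<subseteq> ?E \<union> (?B0 \<union> ((\<Union>j. ?B1 j) \<union> (\<Union>j. ?B2 j)))"
      proof
        fix \<omega> assume \<omega>: "\<omega> \<in> space M"
        show "\<omega> \<in> ?E \<union> (?B0 \<union> ((\<Union>j. ?B1 j) \<union> (\<Union>j. ?B2 j)))"
        proof (rule ccontr)
          assume "\<omega> \<notin> ?E \<union> (?B0 \<union> ((\<Union>j. ?B1 j) \<union> (\<Union>j. ?B2 j)))"
          then have nE: "\<omega> \<notin> ?E" and nB0: "\<omega> \<notin> ?B0"
            and nB1: "\<And>j. \<omega> \<notin> ?B1 j" and nB2: "\<And>j. \<omega> \<notin> ?B2 j"
            by blast+
          have u0: "\<forall>j. ?u \<omega> $ j \<noteq> 0"
            using nB2 \<omega> by blast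
          have "norm (sqrt (real n) *\<^sub>R (?u \<omega> - beta)) \<le> K"
            using nB0 \<omega> by (simp add: u Z_def)
          moreover have "\<delta> \<le> \<bar>sqrt (real n) * ?u \<omega> $ j\<bar>" for j
            using nB1[of j] \<omega> \<delta>(2)[of j] by (simp add: u Z_def algebra_simps)
          ultimately have "(1 / sqrt (lamstar lam n / real n)) *\<^sub>R (AL X lam n (yobs X beta eps n \<omega>) - beta) \<in> U"
            using det kkt_AL[of X n lam, OF inv[OF n] lam] u0 by blast
          then show False
            using nE \<omega> u0 mem_rescaled_image_iff[OF a0] by blast
        qed
      qed
      then have "1 \<le> measure M (?E \<union> (?B0 \<union> ((\<Union>j. ?B1 j) \<union> (\<Union>j. ?B2 j))))"
        using E B0 B1 B2 by (subst M.prob_space[symmetric], intro M.finite_measure_mono) auto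
      also have "\<dots> \<le> measure M ?E + measure M (?B0 \<union> ((\<Union>j. ?B1 j) \<union> (\<Union>j. ?B2 j)))"
        using E B0 B1 B2 by (intro measure_Un_le) auto
      also have "measure M (?B0 \<union> ((\<Union>j. ?B1 j) \<union> (\<Union>j. ?B2 j)))
          \<le> measure M ?B0 + measure M ((\<Union>j. ?B1 j) \<union> (\<Union>j. ?B2 j))"
        using B0 B1 B2 by (intro measure_Un_le) auto
      also have "measure M ((\<Union>j. ?B1 j) \<union> (\<Union>j. ?B2 j))
          \<le> measure M (\<Union>j. ?B1 j) + measure M (\<Union>j. ?B2 j)"
        using B1 B2 by (intro measure_Un_le) auto
      also have "measure M (\<Union>j. ?B1 j) \<le> (\<Sum>j\<in>UNIV. measure M (?B1 j))"
        using B1 by (intro measure_UNION_le) auto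
      also have "\<dots> \<le> (\<Sum>j\<in>(UNIV::'p set). \<eta>)"
        using d2 by (intro sum_mono less_imp_le) blast
      also have "measure M (\<Union>j. ?B2 j) \<le> (\<Sum>j\<in>UNIV. measure M (?B2 j))"
        using B2 by (intro measure_UNION_le) auto
      also have "\<dots> = 0"
        using LS0[OF n] by simp
      finally show ?thesis
        using K unfolding cover_prob_def by (simp add: algebra_simps)
    qed
    then have "1 - (1 + real CARD('p)) * \<eta> \<le> (INF beta. cover_prob M eps X lam n U beta)"
      by (intro cINF_greatest) auto
    moreover have "(INF beta. cover_prob M eps X lam n U beta) \<le> cover_prob M eps X lam n U 0"
      by (rule cINF_lower) (auto simp: cover_prob_def intro!: bdd_belowI[of _ 0])
    moreover have "cover_prob M eps X lam n U 0 \<le> 1"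
      by (simp add: cover_prob_def)
    ultimately show ?case
      using \<eta>(2) by (simp add: dist_real_def)
  qed
qed

text \<open>The infimum is at most the coverage at the single sequence \<open>\<beta> n\<close>,
  where covering forces large noise. Tightness makes the probability of that arbitrarily
  small.\<close>

lemma cover_prob_tendsto_0:
  fixes M :: "'a measure" and eps :: "nat \<Rightarrow> 'a \<Rightarrow> real" and X :: "nat \<Rightarrow> nat \<Rightarrow> real^'p::finite"
    and C S :: "real^'p^'p" and lam :: "nat \<Rightarrow> 'p \<Rightarrow> real"
  assumes prob: "prob_space M" and eps: "\<And>i. eps i \<in> borel_measurable M"
    and inv: "\<And>n. n \<ge> CARD('p) \<Longrightarrow> invertible (XtX X n)"
    and C_lim: "(\<lambda>n. (1 / real n) *\<^sub>R XtX X n) \<longlonglongrightarrow> C" and pd: "pos_def C"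
    and clt: "conv_distr M
        (\<lambda>n \<omega>. sqrt (real n) *\<^sub>R (matrix_inv (XtX X n) *v Xty X n (\<lambda>i. eps i \<omega>))) (mvnormal S)"
    and lam: "\<And>n j. lam n j \<ge> 0"
    and Ln: "(\<lambda>n. lamstar lam n / real n) \<longlonglongrightarrow> 0"
    and L: "filterlim (lamstar lam) at_top sequentially"
    and lam0: "\<And>j. (\<lambda>n. lam n j / lamstar lam n) \<longlonglongrightarrow> lam0 j"
    and range: "\<And>j. lam0 j \<le> 1"
    and psi: "\<And>j. (\<lambda>n. psi_ratio lam n j) \<longlonglongrightarrow> psi j"
    and d: "d < 1"
  shows "(\<lambda>n. INF beta. cover_prob M eps X lam n (Mset C (\<lambda>j. d * lam0 j) psi) beta) \<longlonglongrightarrow> 0"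
proof (rule tendstoI)
  interpret M: prob_space M by (rule prob)
  let ?Md = "Mset C (\<lambda>j. d * lam0 j) psi"
  define e where "e n \<omega> = matrix_inv (XtX X n) *v Xty X n (\<lambda>i. eps i \<omega>)" for n \<omega>
  define Z where "Z n \<omega> = sqrt (real n) *\<^sub>R e n \<omega>" for n \<omega>
  have e[measurable]: "e n \<in> borel_measurable M" for n
    unfolding e_def[abs_def] using eps by (rule borel_measurable_LS_error)
  have Z[measurable]: "Z n \<in> borel_measurable M" for n
    unfolding Z_def[abs_def] by measurable
  have conv: "conv_distr M Z (mvnormal S)"
    using clt by (simp add: Z_def[abs_def] e_def)
  obtain j where j: "lam0 j = 1"
    using lam0 range L by (rule limit_ratio_attains_1)
  \<comment> \<open>An infinite \<open>psi j\<close> would make \<open>lam n j\<close> negligible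
    against \<open>sqrt (lamstar lam n)\<close>, hence against \<open>lamstar lam n\<close>,
    contradicting \<open>lam0 j = 1\<close>. So \<open>Mset\<close> restricts coordinate
    \<open>j\<close> by the product inequality, which the extreme sequence violates.\<close>
  have psi_j: "psi j < \<infinity>"
  proof (rule ccontr)
    assume "\<not> psi j < \<infinity>"
    then have "(\<lambda>n. lam n j / sqrt (lamstar lam n)) \<longlonglongrightarrow> 0"
      using psi[of j] L lam by (intro ratio_tendsto_0_if_psi_ratio_infinite) simp_all
    moreover have "filterlim (\<lambda>n. sqrt (lamstar lam n)) at_infinity sequentially"
      by (intro filterlim_at_top_imp_at_infinity filterlim_compose[OF sqrt_at_top] L)
    ultimately have "(\<lambda>n. lam n j / sqrt (lamstar lam n) / sqrt (lamstar lam n)) \<longlonglongrightarrow> 0"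
      by (rule tendsto_divide_0)
    moreover have "eventually (\<lambda>n. lam n j / sqrt (lamstar lam n) / sqrt (lamstar lam n) = lam n j / lamstar lam n) sequentially"
      using L[unfolded filterlim_at_top_dense, rule_format, of 0] by eventually_elim simp
    ultimately have "(\<lambda>n. lam n j / lamstar lam n) \<longlonglongrightarrow> 0"
      by (rule Lim_transform_eventually)
    then show False
      using lam0[of j] j LIMSEQ_unique by fastforce
  qed
  obtain h where h: "C *v h = axis j 1"
  proof -
    have "inj ((*v) C)"
      using pos_def_injective[OF pd] by (rule injI)
    then have "surj ((*v) C)"
      by (intro linear_injective_imp_surjective) auto
    then show ?thesis
      using that by (metis surjD)
  qed
  define \<beta> :: "nat \<Rightarrow> real^'p" where
    "\<beta> n = (\<chi> k. if k = j then sqrt (lamstar lam n / real n) * sqrt (h $ j) else 1)" for n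
  fix \<epsilon> :: real assume \<epsilon>: "\<epsilon> > 0"
  obtain K where K: "eventually (\<lambda>n. measure M {\<omega> \<in> space M. norm (Z n \<omega>) \<ge> K} < \<epsilon>) sequentially"
    by (rule conv_distr_tight[OF prob Z sets_mvnormal conv \<epsilon>])
  have det: "eventually (\<lambda>n. \<forall>u b. kkt (XtX X n) (lam n) u b \<and> (\<forall>k. u $ k \<noteq> 0) \<and>
      norm (sqrt (real n) *\<^sub>R (u - \<beta> n)) \<le> K
      \<longrightarrow> d < ((1 / sqrt (lamstar lam n / real n)) *\<^sub>R (b - \<beta> n)) $ j
        * (C *v ((1 / sqrt (lamstar lam n / real n)) *\<^sub>R (b - \<beta> n))) $ j) sequentially"
    by (rule rescaled_solution_extreme[of "XtX X" C "lamstar lam" lam lam0 j h \<beta> d K,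
          OF C_lim pd L Ln lam0 j h \<beta>_def d])
  have pos: "eventually (\<lambda>n. lamstar lam n > 0) sequentially"
    using L by (auto simp: filterlim_at_top_dense)
  show "eventually (\<lambda>n. dist (INF beta. cover_prob M eps X lam n ?Md beta) 0 < \<epsilon>) sequentially"
    using K det pos eventually_ge_at_top[of "CARD('p)"]
  proof eventually_elim
    case (elim n)
    note K = elim(1) and det = elim(2) and L0 = elim(3) and n = elim(4)
    have n0: "n > 0"
      using n zero_less_card_finite[where 'a='p] by linarith
    have a0: "sqrt (lamstar lam n / real n) \<noteq> 0"
      using L0 n0 by simp
    have "(INF beta. cover_prob M eps X lam n ?Md beta) \<le> cover_prob M eps X lam n ?Md (\<beta> n)"
      by (rule cINF_lower) (auto simp: cover_prob_def intro!: bdd_belowI[of _ 0])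
    also have "\<dots> \<le> measure M {\<omega> \<in> space M. norm (Z n \<omega>) \<ge> K}"
      unfolding cover_prob_def
    proof (rule M.finite_measure_mono)
      show "{\<omega> \<in> space M. norm (Z n \<omega>) \<ge> K} \<in> sets M"
        by measurable
    next
      show "{\<omega> \<in> space M. (\<forall>j. LS X n (yobs X (\<beta> n) eps n \<omega>) $ j \<noteq> 0) \<and>
          \<beta> n \<in> (\<lambda>s. AL X lam n (yobs X (\<beta> n) eps n \<omega>) - sqrt (lamstar lam n / real n) *\<^sub>R s) ` ?Md}
        \<subseteq> {\<omega> \<in> space M. norm (Z n \<omega>) \<ge> K}"
      proof (intro subsetI CollectI conjI; elim CollectE conjE)
        fix \<omega>
        let ?m = "(1 / sqrt (lamstar lam n / real n)) *\<^sub>R (AL X lam n (yobs X (\<beta> n) eps n \<omega>) - \<beta> n)"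
        assume u0: "\<forall>j. LS X n (yobs X (\<beta> n) eps n \<omega>) $ j \<noteq> 0"
          and "\<beta> n \<in> (\<lambda>s. AL X lam n (yobs X (\<beta> n) eps n \<omega>) - sqrt (lamstar lam n / real n) *\<^sub>R s) ` ?Md"
        then have "?m \<in> ?Md"
          using mem_rescaled_image_iff[OF a0] by blast
        then have "?m $ j * (C *v ?m) $ j \<le> d * lam0 j"
          using psi_j unfolding Mset_def by blast
        then have "\<not> d < ?m $ j * (C *v ?m) $ j"
          unfolding j by (simp only: mult_1_right not_less)
        moreover have "LS X n (yobs X (\<beta> n) eps n \<omega>) = \<beta> n + e n \<omega>"
          unfolding e_def by (rule LS_yobs[OF inv[OF n]])
        ultimately have "\<not> norm (sqrt (real n) *\<^sub>R e n \<omega>) \<le> K"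
          using det u0 kkt_AL[of X n lam, OF inv[OF n] lam] by (metis add_diff_cancel_left')
        then show "norm (Z n \<omega>) \<ge> K"
          by (simp add: Z_def)
      qed
    qed
    also note K
    finally have "(INF beta. cover_prob M eps X lam n ?Md beta) < \<epsilon>" .
    moreover have "0 \<le> (INF beta. cover_prob M eps X lam n ?Md beta)"
      by (rule cINF_greatest) (auto simp: cover_prob_def)
    ultimately show ?case
      by (simp add: dist_real_def)
  qed
qed

theorem theorem4:
  fixes M :: "'a measure" and eps :: "nat \<Rightarrow> 'a \<Rightarrow> real" and \<sigma> :: real
    and X :: "nat \<Rightarrow> nat \<Rightarrow> real^'p::finite" and C :: "real^'p^'p"
    and lam :: "nat \<Rightarrow> 'p \<Rightarrow> real" and lam0 :: "'p \<Rightarrow> real" and psi :: "'p \<Rightarrow> ereal"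
  assumes prob: "prob_space M"
    and eps_rv: "\<And>i. eps i \<in> borel_measurable M"
    and eps_indep: "prob_space.indep_vars M (\<lambda>_. borel) eps UNIV"
    and eps_ident: "\<And>i. distr M borel (eps i) = distr M borel (eps 0)"
    and eps_sq_int: "integrable M (\<lambda>\<omega>. (eps 0 \<omega>)\<^sup>2)"
    and eps_mean: "integral\<^sup>L M (eps 0) = 0"
    and sigma_pos: "\<sigma> > 0"
    and eps_var: "integral\<^sup>L M (\<lambda>\<omega>. (eps 0 \<omega>)\<^sup>2) = \<sigma>\<^sup>2"
    and full_rank: "\<And>n. n \<ge> CARD('p) \<Longrightarrow> invertible (XtX X n)"
    and C_lim: "(\<lambda>n. (1 / real n) *\<^sub>R XtX X n) \<longlonglongrightarrow> C"
    and C_pd: "pos_def C"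
    and clt: "conv_distr M
        (\<lambda>n \<omega>. sqrt (real n) *\<^sub>R (matrix_inv (XtX X n) *v Xty X n (\<lambda>i. eps i \<omega>)))
        (mvnormal (\<sigma>\<^sup>2 *\<^sub>R matrix_inv C))"
    and LS_nonzero: "\<And>n beta j. n \<ge> CARD('p) \<Longrightarrow>
        measure M {\<omega> \<in> space M. LS X n (yobs X beta eps n \<omega>) $ j = 0} = 0"
    and lam_nonneg: "\<And>n j. lam n j \<ge> 0"
    and lam_regime: "\<And>j. eventually (\<lambda>n. lam n j > 0) sequentially \<or>
                           eventually (\<lambda>n. lam n j = 0) sequentially"
    and lam_n: "(\<lambda>n. lamstar lam n / real n) \<longlonglongrightarrow> 0"
    and lam_inf: "filterlim (lamstar lam) at_top sequentially"
    and lam0_lim: "\<And>j. (\<lambda>n. lam n j / lamstar lam n) \<longlonglongrightarrow> lam0 j"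
    and lam0_range: "\<And>j. lam0 j \<in> {0..1}"
    and psi_lim: "\<And>j. (\<lambda>n. psi_ratio lam n j) \<longlonglongrightarrow> psi j"
    and psi_range: "\<And>j. psi j \<ge> 0"
  shows "(\<forall>U. open U \<and> Mset C lam0 psi \<subseteq> U \<longrightarrow>
            (\<lambda>n. INF beta. cover_prob M eps X lam n U beta) \<longlonglongrightarrow> 1)
       \<and> (\<forall>d. 0 < d \<and> d < 1 \<longrightarrow>
            (\<lambda>n. INF beta. cover_prob M eps X lam n (Mset C (\<lambda>j. d * lam0 j) psi) beta) \<longlonglongrightarrow> 0)"
proof (intro conjI allI impI)
  fix U assume "open U \<and> Mset C lam0 psi \<subseteq> U"
  then show "(\<lambda>n. INF beta. cover_prob M eps X lam n U beta) \<longlonglongrightarrow> 1"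
    using cover_prob_tendsto_1[OF prob eps_rv full_rank C_lim C_pd clt LS_nonzero lam_nonneg
        lam_inf lam0_lim psi_lim] by blast
next
  fix d :: real assume "0 < d \<and> d < 1"
  moreover have "lam0 j \<le> 1" for j
    using lam0_range[of j] by simp
  ultimately show "(\<lambda>n. INF beta. cover_prob M eps X lam n (Mset C (\<lambda>j. d * lam0 j) psi) beta) \<longlonglongrightarrow> 0"
    using cover_prob_tendsto_0[OF prob eps_rv full_rank C_lim C_pd clt lam_nonneg lam_n
        lam_inf lam0_lim _ psi_lim] by blast
qed

end
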